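(* Let $G$ be a Lie group acting on the left on a manifold $Q$ via $l^Q$ so that $\pi:Q\to Q/G$ is a principal $G$-bundle. Let $\mathcal{A}_d$ be a discrete connection on $\pi$ with domain $\mathfrak{U}$, let $\mathfrak{U}'=(id_Q\times\pi)(Hor_{\mathcal{A}_d})\subset Q\times(Q/G)$, and let $h_d:\mathfrak{U}'\to Q\times Q$ be its associated discrete horizontal lift. Then the following assertions are true. 1. $\mathfrak{U}'\subset Q\times(Q/G)$ is $G$-invariant for the $G$-action defined by $l^{Q\times(Q/G)}_g(q_0,r_1):=(l^Q_g(q_0),r_1)$ for all $g\in G$. 2. $h_d:\mathfrak{U}'\to Q\times Q$ is smooth and $G$-equivariant for the $G$-actions $l^{Q\times(Q/G)}$ and $l^{Q\times Q}$. 3. $h_d$ is a section over $\mathfrak{U}'$ of $id_Q\times\pi:Q\times Q\to Q\times(Q/G)$; that is, $(id_Q\times\pi)\circ h_d=id_{\mathfrak{U}'}$. 4. For every $q_0\in Q$, $(q_0,\pi(q_0))\in\mathfrak{U}'$ and $h_d(q_0,\pi(q_0))=(q_0,q_0)$. Conversely, let $\mathcal{U}'\subset Q\times(Q/G)$ be an open set that satisfies condition 1 (with $\mathfrak{U}'$ replaced by $\mathcal{U}'$), and let $h:\mathcal{U}'\to Q\times Q$ be a map that satisfies conditions 2, 3 and 4 (with $\mathfrak{U}'$ and $h_d$ replaced by $\mathcal{U}'$ and $h$). Then there exists a unique discrete connection $\mathcal{A}_d$ on $\pi$ with domain $\mathfrak{U}=(id_Q\times\pi)^{-1}(\mathcal{U}')$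 such that $\mathcal{U}'=\mathfrak{U}'$ and $h=h_d$.
   Context: A submanifold (embedded) $Hor\subset Q\times Q$ that is invariant under the diagonal $G$-action $l^{Q\times Q}_g(q_0,q_1)=(l^Q_g(q_0),l^Q_g(q_1))$ and contains the diagonal $\Delta_Q$ is said to define a discrete connection $\mathcal{A}_d$ on $\pi:Q\to Q/G$ if $(id_Q\times\pi)|_{Hor}:Hor\to Q\times(Q/G)$ is an injective local diffeomorphism; one writes $Hor=Hor_{\mathcal{A}_d}$. The domain of the discrete connection is $\mathfrak{U}=\{(q_0,l^Q_g(q_1)):(q_0,q_1)\in Hor_{\mathcal{A}_d},\ g\in G\}\subset Q\times Q$. The set $\mathfrak{U}'=(id_Q\times\pi)(Hor_{\mathcal{A}_d})$ is open in $Q\times(Q/G)$. The associated discrete horizontal lift $h_d:\mathfrak{U}'\to Q\times Q$ is the inverse of the diffeomorphism $(id_Q\times\pi)|_{Hor_{\mathcal{A}_d}}:Hor_{\mathcal{A}_d}\to\mathfrak{U}'$, regarded as a map into $Q\times Q$. That is, $h_d(q_0,r_1)=(q_0,q_1)$ if and only if $(q_0,q_1)\in Hor_{\mathcal{A}_d}$ and $\pi(q_1)=r_1$. *)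

theory Defs
  imports "HOL-Analysis.Analysis" "HOL-Algebra.Group_Action"
begin

section \<open>Smooth maps between subsets of Euclidean spaces\<close>

text \<open>\<open>Ck_on k U f\<close> is meant for open \<open>U\<close>: the map \<open>f\<close> is of class \<open>C\<^sup>k\<close> on \<open>U\<close>.\<close>

primrec Ck_on ::
  "nat \<Rightarrow> 'e::euclidean_space set \<Rightarrow> ('e \<Rightarrow> 'f::euclidean_space) \<Rightarrow> bool" where
  "Ck_on 0 U f \<longleftrightarrow> continuous_on U f"
| "Ck_on (Suc k) U f \<longleftrightarrow>
     f differentiable_on U \<and> (\<forall>v. Ck_on k U (\<lambda>x. frechet_derivative f (at x) v))"

text \<open>On an arbitrary subset (below: a relatively open subset of a linear subspace) smooth
  means locally extendable to a \<open>C\<^sup>\<infinity>\<close> map on an open set.\<close>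

definition smooth_on ::
  "'e::euclidean_space set \<Rightarrow> ('e \<Rightarrow> 'f::euclidean_space) \<Rightarrow> bool" where
  "smooth_on S f \<longleftrightarrow>
     (\<forall>x\<in>S. \<exists>U g. open U \<and> x \<in> U \<and> (\<forall>k. Ck_on k U g) \<and> (\<forall>y\<in>S \<inter> U. g y = f y))"


section \<open>Smooth manifolds\<close>

text \<open>Charts take values in a linear subspace \<open>model M\<close> of a Euclidean space, whose dimension is
  the dimension of the manifold. Modelling on a subspace rather than on the whole type admits
  dimension \<open>0\<close> and lets a submanifold share the type of charts of the ambient manifold.
  A chart is a pair of its domain and a map which is only relevant on that domain.\<close>

record ('a, 'e) manifold =
  mtop :: "'a topology"
  model :: "'e set"
  atlas :: "('a set \<times> ('a \<Rightarrow> 'e)) set"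

abbreviation points :: "('a, 'e) manifold \<Rightarrow> 'a set" where
  "points M \<equiv> topspace (mtop M)"

definition second_countable_space :: "'a topology \<Rightarrow> bool" where
  "second_countable_space X \<longleftrightarrow>
     (\<exists>\<B>. countable \<B> \<and> (\<forall>B\<in>\<B>. openin X B) \<and>
        (\<forall>U x. openin X U \<and> x \<in> U \<longrightarrow> (\<exists>B\<in>\<B>. x \<in> B \<and> B \<subseteq> U)))"

definition is_chart ::
  "('a, 'e::euclidean_space) manifold \<Rightarrow> 'a set \<times> ('a \<Rightarrow> 'e) \<Rightarrow> bool" where
  "is_chart M = (\<lambda>(U, \<phi>).
     openin (mtop M) U \<and> openin (top_of_set (model M)) (\<phi> ` U) \<and>
     homeomorphic_map (subtopology (mtop M) U) (top_of_set (\<phi> ` U)) \<phi>)"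

definition compatible ::
  "'a set \<times> ('a \<Rightarrow> 'e::euclidean_space) \<Rightarrow> 'a set \<times> ('a \<Rightarrow> 'e) \<Rightarrow> bool" where
  "compatible = (\<lambda>(U, \<phi>) (V, \<psi>).
     smooth_on (\<phi> ` (U \<inter> V)) (\<psi> \<circ> inv_into U \<phi>) \<and>
     smooth_on (\<psi> ` (U \<inter> V)) (\<phi> \<circ> inv_into V \<psi>))"

definition smooth_manifold :: "('a, 'e::euclidean_space) manifold \<Rightarrow> bool" where
  "smooth_manifold M \<longleftrightarrow>
     Hausdorff_space (mtop M) \<and> second_countable_space (mtop M) \<and>
     subspace (model M) \<and>
     (\<forall>c\<in>atlas M. is_chart M c) \<and>
     (\<Union>(fst ` atlas M)) = points M \<and>
     (\<forall>c\<in>atlas M. \<forall>d\<in>atlas M. compatible c d)"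

text \<open>The maximal atlas; \<open>atlas M\<close> itself need not be maximal.\<close>

definition smooth_charts ::
  "('a, 'e::euclidean_space) manifold \<Rightarrow> ('a set \<times> ('a \<Rightarrow> 'e)) set" where
  "smooth_charts M = {c. is_chart M c \<and> (\<forall>d\<in>atlas M. compatible c d)}"

definition prod_manifold ::
  "('a, 'e) manifold \<Rightarrow> ('b, 'f) manifold \<Rightarrow> ('a \<times> 'b, 'e \<times> 'f) manifold" where
  "prod_manifold M N =
     \<lparr>mtop = prod_topology (mtop M) (mtop N),
      model = model M \<times> model N,
      atlas = {(U \<times> V, map_prod \<phi> \<psi>) | U \<phi> V \<psi>. (U, \<phi>) \<in> atlas M \<and> (V, \<psi>) \<in> atlas N}\<rparr>"

text \<open>The open submanifold on \<open>S\<close>; meant for \<open>S\<close> open in \<open>M\<close>.\<close>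

definition open_submanifold :: "('a, 'e) manifold \<Rightarrow> 'a set \<Rightarrow> ('a, 'e) manifold" where
  "open_submanifold M S =
     \<lparr>mtop = subtopology (mtop M) S,
      model = model M,
      atlas = {(U \<inter> S, \<phi>) | U \<phi>. (U, \<phi>) \<in> atlas M}\<rparr>"

definition smooth_map ::
  "('a, 'e::euclidean_space) manifold \<Rightarrow> ('b, 'f::euclidean_space) manifold \<Rightarrow>
   ('a \<Rightarrow> 'b) \<Rightarrow> bool" where
  "smooth_map M N f \<longleftrightarrow>
     continuous_map (mtop M) (mtop N) f \<and>
     (\<forall>(U, \<phi>)\<in>atlas M. \<forall>(V, \<psi>)\<in>atlas N.
        smooth_on (\<phi> ` (U \<inter> f -` V)) (\<psi> \<circ> f \<circ> inv_into U \<phi>))"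

definition diffeomorphism ::
  "('a, 'e::euclidean_space) manifold \<Rightarrow> ('b, 'f::euclidean_space) manifold \<Rightarrow>
   ('a \<Rightarrow> 'b) \<Rightarrow> bool" where
  "diffeomorphism M N f \<longleftrightarrow>
     bij_betw f (points M) (points N) \<and> smooth_map M N f \<and>
     smooth_map N M (inv_into (points M) f)"

definition local_diffeomorphism ::
  "('a, 'e::euclidean_space) manifold \<Rightarrow> ('b, 'f::euclidean_space) manifold \<Rightarrow>
   ('a \<Rightarrow> 'b) \<Rightarrow> bool" where
  "local_diffeomorphism M N f \<longleftrightarrow>
     (\<forall>p\<in>points M. \<exists>U. openin (mtop M) U \<and> p \<in> U \<and> openin (mtop N) (f ` U) \<and>
        diffeomorphism (open_submanifold M U) (open_submanifold N (f ` U)) f)"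

text \<open>Embedded submanifolds are given by slice charts. The linear subspace \<open>W\<close> fixes the dimension
  of the submanifold; only its dimension matters, since charts can be composed with linear
  isomorphisms.\<close>

definition slice_charts ::
  "('a, 'e::euclidean_space) manifold \<Rightarrow> 'a set \<Rightarrow> 'e set \<Rightarrow> ('a set \<times> ('a \<Rightarrow> 'e)) set" where
  "slice_charts M S W = {(U, \<phi>) \<in> smooth_charts M. \<phi> ` (U \<inter> S) = \<phi> ` U \<inter> W}"

definition embedded_submanifold ::
  "('a, 'e::euclidean_space) manifold \<Rightarrow> 'a set \<Rightarrow> 'e set \<Rightarrow> bool" where
  "embedded_submanifold M S W \<longleftrightarrow>
     S \<subseteq> points M \<and> subspace W \<and> W \<subseteq> model M \<and>
     (\<forall>p\<in>S. \<exists>(U, \<phi>)\<in>slice_charts M S W. p \<in> U)"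

definition submanifold ::
  "('a, 'e::euclidean_space) manifold \<Rightarrow> 'a set \<Rightarrow> 'e set \<Rightarrow> ('a, 'e) manifold" where
  "submanifold M S W =
     \<lparr>mtop = subtopology (mtop M) S,
      model = W,
      atlas = {(U \<inter> S, \<phi>) | U \<phi>. (U, \<phi>) \<in> slice_charts M S W}\<rparr>"


section \<open>Lie groups, actions and principal bundles\<close>

definition lie_group ::
  "('g, 'x) monoid_scheme \<Rightarrow> ('g, 'd::euclidean_space) manifold \<Rightarrow> bool" where
  "lie_group G MG \<longleftrightarrow>
     group G \<and> smooth_manifold MG \<and> points MG = carrier G \<and>
     smooth_map (prod_manifold MG MG) MG (\<lambda>(x, y). x \<otimes>\<^bsub>G\<^esub> y) \<and>
     smooth_map MG MG (\<lambda>x. inv\<^bsub>G\<^esub> x)"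

definition smooth_action ::
  "('g, 'x) monoid_scheme \<Rightarrow> ('g, 'd::euclidean_space) manifold \<Rightarrow>
   ('q, 'e::euclidean_space) manifold \<Rightarrow> ('g \<Rightarrow> 'q \<Rightarrow> 'q) \<Rightarrow> bool" where
  "smooth_action G MG Q l \<longleftrightarrow>
     group_action G (points Q) l \<and>
     smooth_map (prod_manifold MG Q) Q (\<lambda>(g, q). l g q)"

text \<open>The quotient \<open>Q/G\<close> is the set of orbits, the projection sends a point to its orbit, and
  \<open>B\<close> is the smooth structure on \<open>Q/G\<close>. The last conjunct is \<open>G\<close>-equivariant local triviality,
  \<open>G\<close> acting on \<open>V \<times> G\<close> by left translation of the second factor.\<close>

definition principal_bundle ::
  "('g, 'x) monoid_scheme \<Rightarrow> ('g, 'd::euclidean_space) manifold \<Rightarrow>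
   ('q, 'e::euclidean_space) manifold \<Rightarrow> ('g \<Rightarrow> 'q \<Rightarrow> 'q) \<Rightarrow>
   ('q set, 'b::euclidean_space) manifold \<Rightarrow> bool" where
  "principal_bundle G MG Q l B \<longleftrightarrow>
     lie_group G MG \<and> smooth_manifold Q \<and> smooth_action G MG Q l \<and>
     smooth_manifold B \<and> points B = orbits G (points Q) l \<and>
     smooth_map Q B (orbit G l) \<and>
     (\<forall>r\<in>points B. \<exists>V \<Phi>. openin (mtop B) V \<and> r \<in> V \<and>
        diffeomorphism (open_submanifold Q {q \<in> points Q. orbit G l q \<in> V})
          (prod_manifold (open_submanifold B V) MG) \<Phi> \<and>
        (\<forall>q\<in>points Q. orbit G l q \<in> V \<longrightarrow>
           fst (\<Phi> q) = orbit G l q \<and>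
           (\<forall>g\<in>carrier G. \<Phi> (l g q) = (orbit G l q, g \<otimes>\<^bsub>G\<^esub> snd (\<Phi> q)))))"

definition invariant_set ::
  "('g, 'x) monoid_scheme \<Rightarrow> ('g \<Rightarrow> 'a \<Rightarrow> 'a) \<Rightarrow> 'a set \<Rightarrow> bool" where
  "invariant_set G act S \<longleftrightarrow> (\<forall>g\<in>carrier G. \<forall>x\<in>S. act g x \<in> S)"

definition equivariant_on ::
  "('g, 'x) monoid_scheme \<Rightarrow> 'a set \<Rightarrow> ('g \<Rightarrow> 'a \<Rightarrow> 'a) \<Rightarrow> ('g \<Rightarrow> 'b \<Rightarrow> 'b) \<Rightarrow>
   ('a \<Rightarrow> 'b) \<Rightarrow> bool" where
  "equivariant_on G S actA actB f \<longleftrightarrow>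
     (\<forall>g\<in>carrier G. \<forall>x\<in>S. f (actA g x) = actB g (f x))"

text \<open>The action \<open>(q\<^sub>0, q\<^sub>1) \<mapsto> (g q\<^sub>0, g q\<^sub>1)\<close> on \<open>Q \<times> Q\<close>.\<close>

definition act_QQ :: "('g \<Rightarrow> 'q \<Rightarrow> 'q) \<Rightarrow> 'g \<Rightarrow> 'q \<times> 'q \<Rightarrow> 'q \<times> 'q" where
  "act_QQ l g = map_prod (l g) (l g)"

text \<open>The action \<open>(q\<^sub>0, r\<^sub>1) \<mapsto> (g q\<^sub>0, r\<^sub>1)\<close> on \<open>Q \<times> Q/G\<close>.\<close>

definition act_QB :: "('g \<Rightarrow> 'q \<Rightarrow> 'q) \<Rightarrow> 'g \<Rightarrow> 'q \<times> 'q set \<Rightarrow> 'q \<times> 'q set" where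
  "act_QB l g = map_prod (l g) id"

definition id_times_pi ::
  "('g, 'x) monoid_scheme \<Rightarrow> ('g \<Rightarrow> 'q \<Rightarrow> 'q) \<Rightarrow> 'q \<times> 'q \<Rightarrow> 'q \<times> 'q set" where
  "id_times_pi G l = map_prod id (orbit G l)"


section \<open>Discrete connections\<close>

text \<open>A discrete connection is identified with its horizontal submanifold \<open>Hor\<close>.\<close>

definition discrete_connection ::
  "('g, 'x) monoid_scheme \<Rightarrow> ('q, 'e::euclidean_space) manifold \<Rightarrow> ('g \<Rightarrow> 'q \<Rightarrow> 'q) \<Rightarrow>
   ('q set, 'b::euclidean_space) manifold \<Rightarrow> ('q \<times> 'q) set \<Rightarrow> bool" where
  "discrete_connection G Q l B Hor \<longleftrightarrow>
     invariant_set G (act_QQ l) Hor \<and>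
     Id_on (points Q) \<subseteq> Hor \<and>
     inj_on (id_times_pi G l) Hor \<and>
     (\<exists>W. embedded_submanifold (prod_manifold Q Q) Hor W \<and>
        local_diffeomorphism (submanifold (prod_manifold Q Q) Hor W) (prod_manifold Q B)
          (id_times_pi G l))"

text \<open>The domain \<open>\<UU>\<close> of a discrete connection, and the domain \<open>\<UU>'\<close> of its horizontal lift.\<close>

definition connection_domain ::
  "('g, 'x) monoid_scheme \<Rightarrow> ('g \<Rightarrow> 'q \<Rightarrow> 'q) \<Rightarrow> ('q \<times> 'q) set \<Rightarrow> ('q \<times> 'q) set" where
  "connection_domain G l Hor = {(q0, l g q1) | q0 q1 g. (q0, q1) \<in> Hor \<and> g \<in> carrier G}"

definition lift_domain ::
  "('g, 'x) monoid_scheme \<Rightarrow> ('g \<Rightarrow> 'q \<Rightarrow> 'q) \<Rightarrow> ('q \<times> 'q) set \<Rightarrow> ('q \<times> 'q set) set" where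
  "lift_domain G l Hor = id_times_pi G l ` Hor"

definition horizontal_lift ::
  "('g, 'x) monoid_scheme \<Rightarrow> ('g \<Rightarrow> 'q \<Rightarrow> 'q) \<Rightarrow> ('q \<times> 'q) set \<Rightarrow> 'q \<times> 'q set \<Rightarrow> 'q \<times> 'q" where
  "horizontal_lift G l Hor = the_inv_into Hor (id_times_pi G l)"

end

theory Submission
  imports Defs
begin

text \<open>Write \<open>f\<close> for \<open>id \<times> \<pi>\<close>. A discrete connection is the image of a smooth equivariant section of
  \<open>f\<close> over an open set, and it determines that section.

  From a connection to its lift: \<open>f\<close> restricted to \<open>Hor\<close> is injective and, locally, a diffeomorphism
  onto an open set. Hence the image of \<open>f\<close> is open, and locally the lift is the smooth inverse of
  such a restriction followed by the inclusion of \<open>Hor\<close>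
  (\<open>discrete_connection_local_sections\<close>). Since \<open>f\<close> intertwines the two actions and is injective
  on \<open>Hor\<close>, invariance of \<open>Hor\<close> gives equivariance of the lift.

  From a section to a connection: the only possible choice is \<open>Hor = h ` U'\<close>, which gives uniqueness.
  The substantial point is that this set is an embedded submanifold
  (\<open>section_image_embedded_submanifold\<close>). A local trivialization \<open>\<pi>\<^sup>-\<^sup>1 V \<cong> V \<times> G\<close> identifies
  \<open>Q \<times> \<pi>\<^sup>-\<^sup>1 V\<close> with \<open>(Q \<times> V) \<times> G\<close> in such a way that \<open>f\<close> becomes the projection to \<open>Q \<times> V\<close>. There,
  sections of \<open>f\<close> are graphs of maps into \<open>G\<close>, so \<open>h ` U'\<close> is locally the graph of a smooth map
  \<open>\<gamma>\<close>. A graph is straightened to a slice by subtracting, in a chart of the fibre, the value of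
  \<open>\<gamma>\<close> from the second component (\<open>straighten_graph\<close>, \<open>locally_graph_imp_embedded_submanifold\<close>).
  On this submanifold \<open>f\<close> is a diffeomorphism onto \<open>U'\<close>
  with inverse \<open>h\<close>, because a smooth map with values in an embedded submanifold is smooth into it.

  All these arguments are compositions of smooth maps between different manifolds. To keep them short,
  smoothness is recast as a property \<open>smooth_at\<close> of germs, which can be tested in any charts and is
  insensitive to passing to open submanifolds.\<close>

section \<open>Differential calculus of \<open>C\<^sup>k\<close> maps\<close>

lemma Ck_on_subset: "Ck_on k U f \<Longrightarrow> V \<subseteq> U \<Longrightarrow> Ck_on k V f"
  by (induction k arbitrary: f)
     (auto intro: continuous_on_subset differentiable_on_subset)

lemma Ck_on_SucD:
  assumes "open U" "Ck_on (Suc k) U f" "x \<in> U"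
  shows "(f has_derivative frechet_derivative f (at x)) (at x)"
  using assms by (simp add: differentiable_on_eq_differentiable_at flip: frechet_derivative_works)

lemma Ck_on_cong:
  assumes "open U" "\<And>x. x \<in> U \<Longrightarrow> f x = g x" "Ck_on k U f"
  shows "Ck_on k U g"
  using assms(2,3)
proof (induction k arbitrary: f g)
  case 0
  then show ?case by (simp cong: continuous_on_cong)
next
  case (Suc k)
  have D: "(g has_derivative frechet_derivative f (at x)) (at x)" if "x \<in> U" for x
    by (rule has_derivative_transform_within_open
        [OF Ck_on_SucD[OF assms(1) Suc.prems(2) that] assms(1) that Suc.prems(1)])
  then have "g differentiable_on U"
    using assms(1) by (auto simp: differentiable_on_eq_differentiable_at differentiable_def)
  moreover have "Ck_on k U (\<lambda>x. frechet_derivative g (at x) v)" for v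
  proof (rule Suc.IH)
    show "Ck_on k U (\<lambda>x. frechet_derivative f (at x) v)"
      using Suc.prems(2) by simp
    show "frechet_derivative f (at x) v = frechet_derivative g (at x) v" if "x \<in> U" for x
      using frechet_derivative_at[OF D[OF that]] by simp
  qed
  ultimately show ?case by simp
qed

lemma Ck_on_SucI:
  assumes "open U" "\<And>x. x \<in> U \<Longrightarrow> (f has_derivative D x) (at x)"
    and "\<And>v. Ck_on k U (\<lambda>x. D x v)"
  shows "Ck_on (Suc k) U f"
proof -
  have "f differentiable_on U"
    using assms(1,2) by (auto simp: differentiable_on_eq_differentiable_at differentiable_def)
  moreover have "Ck_on k U (\<lambda>x. frechet_derivative f (at x) v)" for v
  proof (rule Ck_on_cong[OF assms(1) _ assms(3)[of v]])
    fix x assume "x \<in> U"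
    then show "D x v = frechet_derivative f (at x) v"
      using frechet_derivative_at[OF assms(2)] by simp
  qed
  ultimately show ?thesis by simp
qed

lemma Ck_on_decrease: "Ck_on (Suc k) U f \<Longrightarrow> Ck_on k U f"
proof (induction k arbitrary: f)
  case 0
  then show ?case by (auto intro: differentiable_imp_continuous_on)
next
  case (Suc k)
  have "f differentiable_on U" "\<And>v. Ck_on (Suc k) U (\<lambda>x. frechet_derivative f (at x) v)"
    using Suc.prems unfolding Ck_on.simps(2)[of "Suc k"] by blast+
  then show ?case unfolding Ck_on.simps(2)[of k U f] using Suc.IH by blast
qed

lemma Ck_on_const: "Ck_on k U (\<lambda>x. c)"
  by (induction k arbitrary: c) auto

lemma Ck_on_bounded_linear:
  assumes "open U" "bounded_linear L" "Ck_on k U f"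
  shows "Ck_on k U (\<lambda>x. L (f x))"
  using assms(3)
proof (induction k arbitrary: f)
  case 0
  then show ?case using bounded_linear.continuous_on[OF assms(2)] by simp
next
  case (Suc k)
  show ?case
  proof (rule Ck_on_SucI[OF assms(1)])
    fix x assume "x \<in> U"
    then show "((\<lambda>x. L (f x)) has_derivative (\<lambda>v. L (frechet_derivative f (at x) v))) (at x)"
      using Ck_on_SucD[OF assms(1) Suc.prems] bounded_linear.has_derivative[OF assms(2)] by blast
  qed (use Suc assms(1) in auto)
qed

lemma Ck_on_ident: "open U \<Longrightarrow> Ck_on k U (\<lambda>x. x)"
proof (induction k)
  case (Suc k)
  show ?case
    by (rule Ck_on_SucI[OF Suc.prems has_derivative_ident Ck_on_const])
qed auto

lemma Ck_on_add:
  assumes "open U" "Ck_on k U f" "Ck_on k U g"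
  shows "Ck_on k U (\<lambda>x. f x + g x)"
  using assms(2,3)
proof (induction k arbitrary: f g)
  case 0
  then show ?case by (simp add: continuous_on_add)
next
  case (Suc k)
  show ?case
  proof (rule Ck_on_SucI[OF assms(1)])
    fix x assume "x \<in> U"
    then show "((\<lambda>x. f x + g x) has_derivative
        (\<lambda>v. frechet_derivative f (at x) v + frechet_derivative g (at x) v)) (at x)"
      by (intro has_derivative_add Ck_on_SucD[OF assms(1) Suc.prems(1)] Ck_on_SucD[OF assms(1) Suc.prems(2)])
  qed (use Suc assms(1) in auto)
qed

lemma Ck_on_scaleR:
  fixes f :: "'e::euclidean_space \<Rightarrow> real"
  assumes "open U" "Ck_on k U f" "Ck_on k U g"
  shows "Ck_on k U (\<lambda>x. f x *\<^sub>R g x)"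
  using assms(2,3)
proof (induction k arbitrary: f g)
  case 0
  then show ?case by (simp add: continuous_on_scaleR)
next
  case (Suc k)
  show ?case
  proof (rule Ck_on_SucI[OF assms(1)])
    fix x assume "x \<in> U"
    then show "((\<lambda>x. f x *\<^sub>R g x) has_derivative
        (\<lambda>v. f x *\<^sub>R frechet_derivative g (at x) v + frechet_derivative f (at x) v *\<^sub>R g x)) (at x)"
      by (intro has_derivative_scaleR Ck_on_SucD[OF assms(1) Suc.prems(1)] Ck_on_SucD[OF assms(1) Suc.prems(2)])
  next
    fix v
    show "Ck_on k U (\<lambda>x. f x *\<^sub>R frechet_derivative g (at x) v + frechet_derivative f (at x) v *\<^sub>R g x)"
      using Suc.prems Ck_on_decrease[OF Suc.prems(1)] Ck_on_decrease[OF Suc.prems(2)]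
      by (intro Ck_on_add assms(1) Suc.IH) auto
  qed
qed

lemma Ck_on_sum:
  assumes "open U" "\<And>i. i \<in> I \<Longrightarrow> Ck_on k U (f i)"
  shows "Ck_on k U (\<lambda>x. \<Sum>i\<in>I. f i x)"
  using assms(2)
  by (induction I rule: infinite_finite_induct) (auto intro: Ck_on_const Ck_on_add assms(1))

lemma Ck_on_Pair:
  assumes "open U" "Ck_on k U f" "Ck_on k U g"
  shows "Ck_on k U (\<lambda>x. (f x, g x))"
proof -
  have "Ck_on k U (\<lambda>x. (f x, 0) + (0, g x))"
    by (intro Ck_on_add assms(1) Ck_on_bounded_linear[OF assms(1) _ assms(2), of "\<lambda>y. (y, 0)"]
        Ck_on_bounded_linear[OF assms(1) _ assms(3), of "\<lambda>z. (0, z)"] bounded_linear_Pair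
        bounded_linear_ident bounded_linear_zero)
  then show ?thesis by simp
qed

text \<open>The derivative of \<open>g \<circ> f\<close> in direction \<open>v\<close> is the sum over a basis of the coordinates of
  the derivative of \<open>f\<close> times partial derivatives of \<open>g\<close>, composed with \<open>f\<close>. To the latter the
  induction hypothesis applies, as the partial derivatives of \<open>g\<close> are one class less smooth.\<close>

lemma Ck_on_compose:
  fixes f :: "'e::euclidean_space \<Rightarrow> 'f::euclidean_space"
  assumes "open U" "open V" "f ` U \<subseteq> V" "Ck_on k U f" "Ck_on k V g"
  shows "Ck_on k U (\<lambda>x. g (f x))"
  using assms(4,5)
proof (induction k arbitrary: g)
  case 0
  then show ?case using continuous_on_compose2[of V g U f] assms(3) by simp
next
  case (Suc k)
  let ?Df = "\<lambda>x v. frechet_derivative f (at x) v"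
  let ?Dg = "\<lambda>y w. frechet_derivative g (at y) w"
  show ?case
  proof (rule Ck_on_SucI[OF assms(1)])
    fix x assume x: "x \<in> U"
    have g: "(g has_derivative ?Dg (f x)) (at (f x))"
      using Ck_on_SucD[OF assms(2) Suc.prems(2)] x assms(3) by blast
    have "((\<lambda>x. g (f x)) has_derivative (\<lambda>v. ?Dg (f x) (?Df x v))) (at x)"
      by (rule has_derivative_compose[OF Ck_on_SucD[OF assms(1) Suc.prems(1) x] g])
    also have "(\<lambda>v. ?Dg (f x) (?Df x v)) =
        (\<lambda>v. \<Sum>b\<in>Basis. (?Df x v \<bullet> b) *\<^sub>R ?Dg (f x) b)"
    proof
      fix v
      interpret linear "?Dg (f x)"
        using g has_derivative_linear by blast
      have "?Dg (f x) (?Df x v) = ?Dg (f x) (\<Sum>b\<in>Basis. (?Df x v \<bullet> b) *\<^sub>R b)"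
        by (simp add: euclidean_representation)
      then show "?Dg (f x) (?Df x v) = (\<Sum>b\<in>Basis. (?Df x v \<bullet> b) *\<^sub>R ?Dg (f x) b)"
        by (simp add: sum scaleR)
    qed
    finally show "((\<lambda>x. g (f x)) has_derivative
        (\<lambda>v. \<Sum>b\<in>Basis. (?Df x v \<bullet> b) *\<^sub>R ?Dg (f x) b)) (at x)" .
  next
    fix v
    show "Ck_on k U (\<lambda>x. \<Sum>b\<in>Basis. (?Df x v \<bullet> b) *\<^sub>R ?Dg (f x) b)"
      using Suc.prems
      by (intro Ck_on_sum Ck_on_scaleR assms(1) Suc.IH Ck_on_decrease[OF Suc.prems(1)]
          Ck_on_bounded_linear[where L = "\<lambda>w. w \<bullet> b" for b] bounded_linear_inner_left) auto
  qed
qed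


section \<open>Smooth maps on arbitrary sets\<close>

lemma smooth_onI:
  assumes "\<And>x. x \<in> S \<Longrightarrow> \<exists>U g. open U \<and> x \<in> U \<and> (\<forall>k. Ck_on k U g) \<and> (\<forall>y\<in>S \<inter> U. g y = f y)"
  shows "smooth_on S f"
  unfolding smooth_on_def using assms by blast

lemma smooth_onE:
  assumes "smooth_on S f" "x \<in> S"
  obtains U g where "open U" "x \<in> U" "\<And>k. Ck_on k U g" "\<And>y. y \<in> S \<Longrightarrow> y \<in> U \<Longrightarrow> g y = f y"
proof -
  obtain U g where "open U" "x \<in> U" "\<forall>k. Ck_on k U g" "\<forall>y\<in>S \<inter> U. g y = f y"
    using bspec[OF assms(1)[unfolded smooth_on_def] assms(2)] by (elim exE conjE)
  then show ?thesis by (intro that[of U g]) auto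
qed

lemma smooth_on_cong_subset:
  assumes "smooth_on S f" "T \<subseteq> S" "\<And>x. x \<in> T \<Longrightarrow> f x = g x"
  shows "smooth_on T g"
proof (rule smooth_onI)
  fix x assume "x \<in> T"
  then obtain U F where "open U" "x \<in> U" "\<And>k. Ck_on k U F" "\<And>y. y \<in> S \<Longrightarrow> y \<in> U \<Longrightarrow> F y = f y"
    using smooth_onE[OF assms(1), of x] assms(2) by blast
  then show "\<exists>U F. open U \<and> x \<in> U \<and> (\<forall>k. Ck_on k U F) \<and> (\<forall>y\<in>T \<inter> U. F y = g y)"
    using assms(2,3) by (intro exI[of _ U] exI[of _ F]) auto
qed

lemmas smooth_on_subset = smooth_on_cong_subset[OF _ _ refl]
lemmas smooth_on_cong = smooth_on_cong_subset[OF _ order_refl]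

text \<open>Smoothness of maps on arbitrary sets is local in the relative topology: a smooth extension of the
  restriction to a relatively open subset is one of the whole map after shrinking its domain.\<close>

lemma smooth_on_local:
  assumes "\<And>x. x \<in> S \<Longrightarrow> \<exists>U. openin (top_of_set S) U \<and> x \<in> U \<and> smooth_on U f"
  shows "smooth_on S f"
proof (rule smooth_onI)
  fix x assume "x \<in> S"
  then obtain U where U: "openin (top_of_set S) U" "x \<in> U" "smooth_on U f"
    using assms by blast
  then obtain O1 where O1: "open O1" "U = S \<inter> O1"
    by (auto simp: openin_open)
  obtain O2 g where g: "open O2" "x \<in> O2" "\<And>k. Ck_on k O2 g"
      "\<And>y. y \<in> U \<Longrightarrow> y \<in> O2 \<Longrightarrow> g y = f y"
    using smooth_onE[OF U(3,2)] by blast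
  show "\<exists>U g. open U \<and> x \<in> U \<and> (\<forall>k. Ck_on k U g) \<and> (\<forall>y\<in>S \<inter> U. g y = f y)"
    by (rule exI[of _ "O1 \<inter> O2"], rule exI[of _ g])
       (use U O1 g in \<open>auto intro: Ck_on_subset\<close>)
qed

lemma smooth_on_imp_continuous_on:
  assumes "smooth_on S f"
  shows "continuous_on S f"
  unfolding continuous_on_eq_continuous_within
proof
  fix x assume x: "x \<in> S"
  then obtain U g where g: "open U" "x \<in> U" "\<And>k. Ck_on k U g" "\<And>y. y \<in> S \<Longrightarrow> y \<in> U \<Longrightarrow> g y = f y"
    using smooth_onE[OF assms] by blast
  have "continuous_on U g"
    using g(3)[of 0] by simp
  then have "continuous (at x within S) g"
    using g(1,2) continuous_at_imp_continuous_at_within continuous_on_eq_continuous_at by blast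
  moreover have "\<forall>\<^sub>F y in at x within S. y \<in> U"
    using g(1,2) by (simp add: eventually_at_topological) blast
  then have "\<forall>\<^sub>F y in at x within S. g y = f y"
    using g(4) by (auto simp: eventually_at_filter elim!: eventually_mono)
  ultimately show "continuous (at x within S) f"
    using g(2,4) x by (simp add: continuous_within filterlim_cong)
qed

lemma smooth_on_compose:
  assumes "smooth_on S f" "smooth_on T g" "f ` S \<subseteq> T"
  shows "smooth_on S (g \<circ> f)"
proof (rule smooth_onI)
  fix x assume x: "x \<in> S"
  obtain U F where F: "open U" "x \<in> U" "\<And>k. Ck_on k U F" "\<And>y. y \<in> S \<Longrightarrow> y \<in> U \<Longrightarrow> F y = f y"
    using smooth_onE[OF assms(1) x] by blast
  obtain V H where H: "open V" "f x \<in> V" "\<And>k. Ck_on k V H" "\<And>y. y \<in> T \<Longrightarrow> y \<in> V \<Longrightarrow> H y = g y"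
    using smooth_onE[OF assms(2)] x assms(3) by blast
  let ?U = "U \<inter> F -` V"
  have "continuous_on U F"
    using F(3)[of 0] by simp
  then have o: "open ?U"
    using F(1) H(1) continuous_open_preimage by blast
  have "Ck_on k ?U (\<lambda>x. H (F x))" for k
    by (rule Ck_on_compose[OF o H(1) _ Ck_on_subset[OF F(3)] H(3)]) auto
  then show "\<exists>U h. open U \<and> x \<in> U \<and> (\<forall>k. Ck_on k U h) \<and> (\<forall>y\<in>S \<inter> U. h y = (g \<circ> f) y)"
    using o x F H assms(3)
    by (intro exI[of _ ?U] exI[of _ "\<lambda>x. H (F x)"]) (auto simp: image_subset_iff)
qed

lemma smooth_on_Pair:
  assumes "smooth_on S f" "smooth_on S g"
  shows "smooth_on S (\<lambda>x. (f x, g x))"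
proof (rule smooth_onI)
  fix x assume x: "x \<in> S"
  obtain U F where F: "open U" "x \<in> U" "\<And>k. Ck_on k U F" "\<And>y. y \<in> S \<Longrightarrow> y \<in> U \<Longrightarrow> F y = f y"
    using smooth_onE[OF assms(1) x] by blast
  obtain V H where H: "open V" "x \<in> V" "\<And>k. Ck_on k V H" "\<And>y. y \<in> S \<Longrightarrow> y \<in> V \<Longrightarrow> H y = g y"
    using smooth_onE[OF assms(2) x] by blast
  show "\<exists>U h. open U \<and> x \<in> U \<and> (\<forall>k. Ck_on k U h) \<and> (\<forall>y\<in>S \<inter> U. h y = (f y, g y))"
    by (rule exI[of _ "U \<inter> V"], rule exI[of _ "\<lambda>x. (F x, H x)"])
       (use F H in \<open>auto intro!: Ck_on_Pair intro: Ck_on_subset\<close>)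
qed

lemma smooth_on_linear:
  fixes L :: "'e::euclidean_space \<Rightarrow> 'f::euclidean_space"
  assumes "linear L"
  shows "smooth_on S L"
  using assms Ck_on_bounded_linear[OF open_UNIV _ Ck_on_ident[OF open_UNIV], of L]
  by (intro smooth_onI exI[of _ UNIV] exI[of _ L]) (auto simp: linear_linear)

section \<open>Charts\<close>

lemma is_chartD:
  assumes "is_chart M (U, \<phi>)"
  shows "openin (mtop M) U" "openin (top_of_set (model M)) (\<phi> ` U)" "inj_on \<phi> U" "\<phi> ` U \<subseteq> model M"
    "U \<subseteq> points M"
proof -
  show U: "openin (mtop M) U" and im: "openin (top_of_set (model M)) (\<phi> ` U)"
    using assms by (auto simp: is_chart_def)
  show "U \<subseteq> points M"
    using U openin_subset by blast
  then show "inj_on \<phi> U"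
    using assms homeomorphic_imp_injective_map[of "subtopology (mtop M) U" _ \<phi>]
    by (auto simp: is_chart_def Int_absorb1)
  show "\<phi> ` U \<subseteq> model M"
    using openin_subset[OF im] by simp
qed

lemma is_chart_image_openin:
  assumes "is_chart M (U, \<phi>)" "openin (mtop M) A" "A \<subseteq> U"
  shows "openin (top_of_set (model M)) (\<phi> ` A)"
proof -
  have "homeomorphic_map (subtopology (mtop M) U) (top_of_set (\<phi> ` U)) \<phi>"
    using assms(1) by (simp add: is_chart_def)
  then have "openin (top_of_set (\<phi> ` U)) (\<phi> ` A)"
    using assms(2,3) homeomorphic_imp_open_map open_map_def openin_subset_topspace_eq
    by (metis openin_open_subtopology assms(1) is_chartD(1))
  then show ?thesis
    using is_chartD(2)[OF assms(1)] openin_trans by blast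
qed

lemma is_chart_vimage_openin:
  assumes "is_chart M (U, \<phi>)" "open T"
  shows "openin (mtop M) {x\<in>U. \<phi> x \<in> T}"
proof -
  have "continuous_map (subtopology (mtop M) U) (top_of_set (\<phi> ` U)) \<phi>"
    using assms(1) homeomorphic_imp_continuous_map by (auto simp: is_chart_def)
  then have "openin (subtopology (mtop M) U) {x \<in> topspace (subtopology (mtop M) U). \<phi> x \<in> \<phi> ` U \<inter> T}"
    using openin_continuous_map_preimage openin_open_Int assms(2) by blast
  moreover have "{x \<in> topspace (subtopology (mtop M) U). \<phi> x \<in> \<phi> ` U \<inter> T} = {x\<in>U. \<phi> x \<in> T}"
    using is_chartD(5)[OF assms(1)] by auto
  ultimately show ?thesis
    using is_chartD(1)[OF assms(1)] openin_trans_full by metis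
qed

text \<open>A homeomorphism onto an open set can be recognised on open sets of the whole spaces, without
  mention of subspace topologies.\<close>

lemma is_chartI:
  assumes "openin (mtop M) U" "inj_on \<phi> U"
    and im: "\<And>A. openin (mtop M) A \<Longrightarrow> A \<subseteq> U \<Longrightarrow> openin (top_of_set (model M)) (\<phi> ` A)"
    and vim: "\<And>T. open T \<Longrightarrow> openin (mtop M) {x\<in>U. \<phi> x \<in> T}"
  shows "is_chart M (U, \<phi>)"
proof -
  have U: "topspace (subtopology (mtop M) U) = U"
    using openin_subset[OF assms(1)] by auto
  have "homeomorphic_map (subtopology (mtop M) U) (top_of_set (\<phi> ` U)) \<phi>"
  proof (rule bijective_open_imp_homeomorphic_map)
    show "continuous_map (subtopology (mtop M) U) (top_of_set (\<phi> ` U)) \<phi>"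
      unfolding continuous_map_def U
    proof (intro conjI allI impI)
      fix Z assume "openin (top_of_set (\<phi> ` U)) Z"
      then obtain T where T: "open T" "Z = \<phi> ` U \<inter> T"
        by (auto simp: openin_open)
      then have "{x\<in>U. \<phi> x \<in> Z} = {x\<in>U. \<phi> x \<in> T}" by auto
      then show "openin (subtopology (mtop M) U) {x\<in>U. \<phi> x \<in> Z}"
        using vim[OF T(1)] openin_open_subtopology[OF assms(1)] by auto
    qed auto
    show "open_map (subtopology (mtop M) U) (top_of_set (\<phi> ` U)) \<phi>"
      unfolding open_map_def
    proof (intro allI impI)
      fix A assume "openin (subtopology (mtop M) U) A"
      then have "openin (mtop M) A" "A \<subseteq> U"
        using openin_open_subtopology[OF assms(1)] by auto
      then have "openin (top_of_set (model M)) (\<phi> ` A)" "\<phi> ` A \<subseteq> \<phi> ` U"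
        using im by auto
      then show "openin (top_of_set (\<phi> ` U)) (\<phi> ` A)"
        using openin_subset_trans[of "model M" "\<phi> ` A" "\<phi> ` U"] im[OF assms(1)] openin_subset by fastforce
    qed
  qed (use U assms(2) in auto)
  then show ?thesis
    using assms(1) im[OF assms(1)] by (simp add: is_chart_def)
qed

text \<open>The part of a manifold structure that is visible to local arguments. It passes from a manifold
  to products, open subsets and embedded submanifolds.\<close>

definition smooth_atlas :: "('a, 'e::euclidean_space) manifold \<Rightarrow> bool" where
  "smooth_atlas M \<longleftrightarrow>
     subspace (model M) \<and> (\<forall>c\<in>atlas M. is_chart M c) \<and> \<Union>(fst ` atlas M) = points M \<and>
     (\<forall>c\<in>atlas M. \<forall>d\<in>atlas M. compatible c d)"

lemma smooth_manifold_imp_smooth_atlas: "smooth_manifold M \<Longrightarrow> smooth_atlas M"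
  by (simp add: smooth_manifold_def smooth_atlas_def)

lemma atlas_subset_smooth_charts: "smooth_atlas M \<Longrightarrow> atlas M \<subseteq> smooth_charts M"
  by (auto simp: smooth_atlas_def smooth_charts_def)

lemma atlas_chartE:
  assumes "smooth_atlas M" "x \<in> points M"
  obtains U \<phi> where "(U, \<phi>) \<in> atlas M" "(U, \<phi>) \<in> smooth_charts M" "x \<in> U"
proof -
  have "x \<in> \<Union>(fst ` atlas M)"
    using assms by (simp add: smooth_atlas_def)
  then obtain c where c: "c \<in> atlas M" "x \<in> fst c" by blast
  then show ?thesis
    using that[of "fst c" "snd c"] atlas_subset_smooth_charts[OF assms(1)] by auto
qed

lemma smooth_charts_is_chart: "(U, \<phi>) \<in> smooth_charts M \<Longrightarrow> is_chart M (U, \<phi>)"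
  by (simp add: smooth_charts_def)

lemmas smooth_chartsD = is_chartD[OF smooth_charts_is_chart]

lemma inv_into_chart [simp]:
  assumes "(U, \<phi>) \<in> smooth_charts M" "x \<in> U"
  shows "inv_into U \<phi> (\<phi> x) = x"
  using assms smooth_chartsD(3) inv_into_f_f by metis

text \<open>Near a given point, the change between two charts of the maximal atlas is the composition of
  their changes to and from a chart of the atlas.\<close>

lemma smooth_charts_compatible:
  assumes M: "smooth_atlas M" and c: "(U, \<phi>) \<in> smooth_charts M" and d: "(V, \<psi>) \<in> smooth_charts M"
  shows "smooth_on (\<phi> ` (U \<inter> V)) (\<psi> \<circ> inv_into U \<phi>)"
proof (rule smooth_on_local)
  fix y assume "y \<in> \<phi> ` (U \<inter> V)"
  then obtain x where x: "x \<in> U" "x \<in> V" "y = \<phi> x" by blast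
  obtain W \<eta> where w: "(W, \<eta>) \<in> atlas M" "(W, \<eta>) \<in> smooth_charts M" "x \<in> W"
    using atlas_chartE[OF M] x(1) smooth_chartsD(5)[OF c] by blast
  let ?T = "\<phi> ` (U \<inter> V \<inter> W)"
  have "openin (mtop M) (U \<inter> V)" "openin (mtop M) (U \<inter> V \<inter> W)"
    using smooth_chartsD(1)[OF c] smooth_chartsD(1)[OF d] smooth_chartsD(1)[OF w(2)] by blast+
  then have o: "openin (top_of_set (model M)) (\<phi> ` (U \<inter> V))" "openin (top_of_set (model M)) ?T"
    using is_chart_image_openin[OF smooth_charts_is_chart[OF c]] by blast+
  have "openin (top_of_set (\<phi> ` (U \<inter> V))) ?T"
    by (rule openin_subset_trans[OF o(2)]) (use openin_subset[OF o(1)] in auto)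
  moreover have "smooth_on (\<phi> ` (U \<inter> W)) (\<eta> \<circ> inv_into U \<phi>)"
    using c w(1) by (auto simp: smooth_charts_def compatible_def)
  then have "smooth_on ?T (\<eta> \<circ> inv_into U \<phi>)"
    by (rule smooth_on_subset) auto
  moreover have "smooth_on (\<eta> ` (V \<inter> W)) (\<psi> \<circ> inv_into W \<eta>)"
    using d w(1) by (auto simp: smooth_charts_def compatible_def)
  ultimately have "smooth_on ?T ((\<psi> \<circ> inv_into W \<eta>) \<circ> (\<eta> \<circ> inv_into U \<phi>))"
    by (intro smooth_on_compose) (use c in auto)
  then have "smooth_on ?T (\<psi> \<circ> inv_into U \<phi>)"
    by (rule smooth_on_cong) (use c w in auto)
  then show "\<exists>T. openin (top_of_set (\<phi> ` (U \<inter> V))) T \<and> y \<in> T \<and> smooth_on T (\<psi> \<circ> inv_into U \<phi>)"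
    using \<open>openin (top_of_set (\<phi> ` (U \<inter> V))) ?T\<close> x w(3) by blast
qed


section \<open>Smoothness at a point\<close>

text \<open>Smoothness of the germ of \<open>f\<close> at \<open>x\<close>. Continuity is built in: \<open>f\<close> maps an
  open set into the domain of a single chart, where it is conjugate to a continuous map.\<close>

definition smooth_at ::
  "('a, 'e::euclidean_space) manifold \<Rightarrow> ('b, 'f::euclidean_space) manifold \<Rightarrow>
   ('a \<Rightarrow> 'b) \<Rightarrow> 'a \<Rightarrow> bool" where
  "smooth_at M N f x \<longleftrightarrow>
     (\<exists>U \<phi> V \<psi> D. (U, \<phi>) \<in> smooth_charts M \<and> (V, \<psi>) \<in> smooth_charts N \<and>
        openin (mtop M) D \<and> x \<in> D \<and> D \<subseteq> U \<and> f ` D \<subseteq> V \<and>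
        smooth_on (\<phi> ` D) (\<psi> \<circ> f \<circ> inv_into U \<phi>))"

lemma smooth_atI:
  assumes "(U, \<phi>) \<in> smooth_charts M" "(V, \<psi>) \<in> smooth_charts N" "openin (mtop M) D" "x \<in> D"
    "D \<subseteq> U" "f ` D \<subseteq> V" "smooth_on (\<phi> ` D) (\<psi> \<circ> f \<circ> inv_into U \<phi>)"
  shows "smooth_at M N f x"
  using assms unfolding smooth_at_def by blast

lemma smooth_atE:
  assumes "smooth_at M N f x"
  obtains U \<phi> V \<psi> D where "(U, \<phi>) \<in> smooth_charts M" "(V, \<psi>) \<in> smooth_charts N" "openin (mtop M) D" "x \<in> D"
    "D \<subseteq> U" "f ` D \<subseteq> V" "smooth_on (\<phi> ` D) (\<psi> \<circ> f \<circ> inv_into U \<phi>)"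
  using assms unfolding smooth_at_def by blast

lemma smooth_at_in_points:
  assumes "smooth_at M N f x"
  shows "x \<in> points M" "f x \<in> points N"
  using smooth_atE[OF assms] smooth_chartsD(5) by (metis subsetD image_subset_iff)+

text \<open>This is the continuity of a map whose representation in charts is smooth. It is needed to shrink
  domains before smoothness is known to be independent of the charts.\<close>

lemma chart_representation_openin:
  assumes c: "is_chart M (U, \<phi>)" and d: "is_chart N (V, \<psi>)"
    and D: "openin (mtop M) D" "D \<subseteq> U" "f ` D \<subseteq> V"
    and r: "smooth_on (\<phi> ` D) (\<psi> \<circ> f \<circ> inv_into U \<phi>)"
    and T: "openin (mtop N) T"
  shows "openin (mtop M) {x\<in>D. f x \<in> T}"
proof -
  let ?r = "\<psi> \<circ> f \<circ> inv_into U \<phi>"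
  have inv: "inv_into U \<phi> (\<phi> x) = x" if "x \<in> D" for x
    using that D(2) is_chartD(3)[OF c] by (simp add: subsetD)
  have "openin (top_of_set (model N)) (\<psi> ` (V \<inter> T))"
    using T is_chartD(1)[OF d] by (intro is_chart_image_openin[OF d]) auto
  then obtain Z where Z: "open Z" "\<psi> ` (V \<inter> T) = model N \<inter> Z"
    by (auto simp: openin_open)
  have "f x \<in> T \<longleftrightarrow> \<psi> (f x) \<in> Z" if "x \<in> D" for x
  proof -
    have v: "f x \<in> V" "\<psi> (f x) \<in> model N"
      using that D(3) is_chartD(4)[OF d] by blast+
    then have "\<psi> (f x) \<in> Z \<longleftrightarrow> \<psi> (f x) \<in> \<psi> ` (V \<inter> T)"
      using Z(2) by blast
    also have "\<dots> \<longleftrightarrow> f x \<in> T"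
      using v(1) is_chartD(3)[OF d] by (auto dest: inj_onD)
    finally show ?thesis by simp
  qed
  moreover have "openin (top_of_set (\<phi> ` D)) (\<phi> ` D \<inter> ?r -` Z)"
    using smooth_on_imp_continuous_on[OF r] Z(1) continuous_openin_preimage_gen by blast
  then obtain Y where Y: "open Y" "\<phi> ` D \<inter> ?r -` Z = \<phi> ` D \<inter> Y"
    by (auto simp: openin_open)
  moreover have "\<psi> (f x) \<in> Z \<longleftrightarrow> \<phi> x \<in> Y" if "x \<in> D" for x
  proof -
    have "\<phi> x \<in> \<phi> ` D \<inter> ?r -` Z \<longleftrightarrow> \<phi> x \<in> \<phi> ` D \<inter> Y"
      using Y(2) by simp
    then show ?thesis
      using that inv[OF that] by simp
  qed
  ultimately have "{x\<in>D. f x \<in> T} = D \<inter> {x\<in>U. \<phi> x \<in> Y}"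
    using D(2) by auto
  then show ?thesis
    using D(1) is_chart_vimage_openin[OF c Y(1)] by (simp add: openin_Int)
qed

lemma openin_preimage_smooth_at:
  assumes "\<And>x. x \<in> A \<Longrightarrow> smooth_at M N f x" "openin (mtop M) A" "openin (mtop N) T"
  shows "openin (mtop M) {x\<in>A. f x \<in> T}"
proof (subst openin_subopen, intro ballI)
  fix x assume "x \<in> {x\<in>A. f x \<in> T}"
  then have x: "x \<in> A" "f x \<in> T" by auto
  obtain U \<phi> V \<psi> D where D: "(U, \<phi>) \<in> smooth_charts M" "(V, \<psi>) \<in> smooth_charts N" "openin (mtop M) D"
    "x \<in> D" "D \<subseteq> U" "f ` D \<subseteq> V" "smooth_on (\<phi> ` D) (\<psi> \<circ> f \<circ> inv_into U \<phi>)"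
    using smooth_atE[OF assms(1)[OF x(1)]] by metis
  have "openin (mtop M) {x\<in>D. f x \<in> T}"
    by (rule chart_representation_openin[OF smooth_charts_is_chart smooth_charts_is_chart])
       (use D assms(3) in auto)
  then have "openin (mtop M) ({x\<in>D. f x \<in> T} \<inter> A)"
    using assms(2) by blast
  then show "\<exists>S. openin (mtop M) S \<and> x \<in> S \<and> S \<subseteq> {x\<in>A. f x \<in> T}"
    using D(4) x by blast
qed

lemma smooth_at_cong:
  assumes "smooth_at M N f x" "openin (mtop M) A" "x \<in> A" "\<And>y. y \<in> A \<Longrightarrow> f y = g y"
  shows "smooth_at M N g x"
proof -
  obtain U \<phi> V \<psi> D where D: "(U, \<phi>) \<in> smooth_charts M" "(V, \<psi>) \<in> smooth_charts N" "openin (mtop M) D"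
    "x \<in> D" "D \<subseteq> U" "f ` D \<subseteq> V" "smooth_on (\<phi> ` D) (\<psi> \<circ> f \<circ> inv_into U \<phi>)"
    using smooth_atE[OF assms(1)] by metis
  show ?thesis
  proof (rule smooth_atI[OF D(1,2), of "D \<inter> A"])
    show "g ` (D \<inter> A) \<subseteq> V" using D(6) assms(4) by force
    show "smooth_on (\<phi> ` (D \<inter> A)) (\<psi> \<circ> g \<circ> inv_into U \<phi>)"
    proof (rule smooth_on_cong_subset[OF D(7)])
      fix z assume "z \<in> \<phi> ` (D \<inter> A)"
      then obtain y where "y \<in> D" "y \<in> A" "z = \<phi> y" by blast
      then show "(\<psi> \<circ> f \<circ> inv_into U \<phi>) z = (\<psi> \<circ> g \<circ> inv_into U \<phi>) z"
        using D(1,5) assms(4) by (simp add: subsetD)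
    qed auto
  qed (use D assms in auto)
qed

text \<open>As any two charts of the maximal atlas are compatible, smoothness at a point may be tested
  in whichever charts are convenient.\<close>

lemma smooth_at_chartsE:
  assumes M: "smooth_atlas M" and N: "smooth_atlas N" and f: "smooth_at M N f x"
    and c: "(U, \<phi>) \<in> smooth_charts M" "x \<in> U" and d: "(V, \<psi>) \<in> smooth_charts N" "f x \<in> V"
  obtains D where "openin (mtop M) D" "x \<in> D" "D \<subseteq> U" "f ` D \<subseteq> V"
    "smooth_on (\<phi> ` D) (\<psi> \<circ> f \<circ> inv_into U \<phi>)"
proof -
  obtain U' \<phi>' V' \<psi>' D' where D': "(U', \<phi>') \<in> smooth_charts M" "(V', \<psi>') \<in> smooth_charts N"
    "openin (mtop M) D'" "x \<in> D'" "D' \<subseteq> U'" "f ` D' \<subseteq> V'"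
    "smooth_on (\<phi>' ` D') (\<psi>' \<circ> f \<circ> inv_into U' \<phi>')"
    using smooth_atE[OF f] by metis
  let ?D = "{y\<in>D'. f y \<in> V} \<inter> U"
  have "openin (mtop M) {y\<in>D'. f y \<in> V}"
    by (rule chart_representation_openin[OF smooth_charts_is_chart[OF D'(1)]
          smooth_charts_is_chart[OF D'(2)]]) (use D' smooth_chartsD(1)[OF d(1)] in auto)
  then have o: "openin (mtop M) ?D"
    using smooth_chartsD(1)[OF c(1)] by blast
  have "smooth_on (\<phi> ` ?D) (\<phi>' \<circ> inv_into U \<phi>)"
    by (rule smooth_on_subset[OF smooth_charts_compatible[OF M c(1) D'(1)]]) (use D'(5) in auto)
  moreover have "(\<phi>' \<circ> inv_into U \<phi>) ` \<phi> ` ?D \<subseteq> \<phi>' ` D'"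
    using c(1) by auto
  ultimately have "smooth_on (\<phi> ` ?D) ((\<psi>' \<circ> f \<circ> inv_into U' \<phi>') \<circ> (\<phi>' \<circ> inv_into U \<phi>))"
    using smooth_on_compose[OF _ D'(7)] by blast
  moreover have "((\<psi>' \<circ> f \<circ> inv_into U' \<phi>') \<circ> (\<phi>' \<circ> inv_into U \<phi>)) ` \<phi> ` ?D \<subseteq> \<psi>' ` (V' \<inter> V)"
    using c(1) D'(1,5,6) by (auto simp: subset_eq)
  ultimately have "smooth_on (\<phi> ` ?D)
      ((\<psi> \<circ> inv_into V' \<psi>') \<circ> ((\<psi>' \<circ> f \<circ> inv_into U' \<phi>') \<circ> (\<phi>' \<circ> inv_into U \<phi>)))"
    using smooth_on_compose[OF _ smooth_charts_compatible[OF N D'(2) d(1)]] by blast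
  then have "smooth_on (\<phi> ` ?D) (\<psi> \<circ> f \<circ> inv_into U \<phi>)"
  proof (rule smooth_on_cong)
    fix z assume "z \<in> \<phi> ` ?D"
    then obtain y where y: "y \<in> D'" "f y \<in> V" "y \<in> U" "z = \<phi> y" by blast
    then have "f y \<in> V'" "y \<in> U'" using D' by auto
    then show "((\<psi> \<circ> inv_into V' \<psi>') \<circ> ((\<psi>' \<circ> f \<circ> inv_into U' \<phi>') \<circ> (\<phi>' \<circ> inv_into U \<phi>))) z =
        (\<psi> \<circ> f \<circ> inv_into U \<phi>) z"
      using y c(1) D'(1,2) by simp
  qed
  then show ?thesis
    using that[of ?D] o c(2) d(2) D'(4) by auto
qed

lemma smooth_at_compose:
  assumes M: "smooth_atlas M" and N: "smooth_atlas N"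
    and f: "smooth_at M N f x" and g: "smooth_at N P g (f x)"
  shows "smooth_at M P (\<lambda>y. g (f y)) x"
proof -
  obtain V \<psi> W \<eta> D' where D': "(V, \<psi>) \<in> smooth_charts N" "(W, \<eta>) \<in> smooth_charts P" "openin (mtop N) D'"
    "f x \<in> D'" "D' \<subseteq> V" "g ` D' \<subseteq> W" "smooth_on (\<psi> ` D') (\<eta> \<circ> g \<circ> inv_into V \<psi>)"
    using smooth_atE[OF g] by metis
  obtain U \<phi> where c: "(U, \<phi>) \<in> smooth_charts M" "x \<in> U"
    using atlas_chartE[OF M smooth_at_in_points(1)[OF f]] by metis
  obtain D where D: "openin (mtop M) D" "x \<in> D" "D \<subseteq> U" "f ` D \<subseteq> V"
    "smooth_on (\<phi> ` D) (\<psi> \<circ> f \<circ> inv_into U \<phi>)"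
    using smooth_at_chartsE[OF M N f c D'(1)] D'(4,5) by blast
  let ?D = "{y\<in>D. f y \<in> D'}"
  have o: "openin (mtop M) ?D"
    by (rule chart_representation_openin[OF smooth_charts_is_chart[OF c(1)]
          smooth_charts_is_chart[OF D'(1)]]) (use D D' in auto)
  have "smooth_on (\<phi> ` ?D) ((\<eta> \<circ> g \<circ> inv_into V \<psi>) \<circ> (\<psi> \<circ> f \<circ> inv_into U \<phi>))"
    by (rule smooth_on_compose[OF smooth_on_subset[OF D(5)] D'(7)])
       (use c(1) D(3) in \<open>auto simp: subset_eq\<close>)
  then have "smooth_on (\<phi> ` ?D) (\<eta> \<circ> (\<lambda>y. g (f y)) \<circ> inv_into U \<phi>)"
  proof (rule smooth_on_cong)
    fix z assume "z \<in> \<phi> ` ?D"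
    then obtain y where y: "y \<in> D" "f y \<in> D'" "z = \<phi> y" by blast
    then have "y \<in> U" "f y \<in> V" using D D' by auto
    then show "((\<eta> \<circ> g \<circ> inv_into V \<psi>) \<circ> (\<psi> \<circ> f \<circ> inv_into U \<phi>)) z = (\<eta> \<circ> (\<lambda>y. g (f y)) \<circ> inv_into U \<phi>) z"
      using y(3) c(1) D'(1) by simp
  qed
  then show ?thesis
    using D D' by (intro smooth_atI[OF c(1) D'(2) o]) auto
qed

lemma smooth_map_imp_smooth_at:
  assumes M: "smooth_atlas M" and N: "smooth_atlas N" and f: "smooth_map M N f" and x: "x \<in> points M"
  shows "smooth_at M N f x"
proof -
  have cont: "continuous_map (mtop M) (mtop N) f"
    using f by (simp add: smooth_map_def)
  then have "f x \<in> points N"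
    using x by (auto simp: continuous_map_def)
  then obtain V \<psi> where d: "(V, \<psi>) \<in> atlas N" "(V, \<psi>) \<in> smooth_charts N" "f x \<in> V"
    using atlas_chartE[OF N] by metis
  obtain U \<phi> where c: "(U, \<phi>) \<in> atlas M" "(U, \<phi>) \<in> smooth_charts M" "x \<in> U"
    using atlas_chartE[OF M x] by metis
  have "openin (mtop M) (U \<inter> {y \<in> points M. f y \<in> V})"
    using cont smooth_chartsD(1)[OF c(2)] smooth_chartsD(1)[OF d(2)]
    by (intro openin_Int) (auto simp: continuous_map_def)
  moreover have "U \<inter> {y \<in> points M. f y \<in> V} = U \<inter> f -` V"
    using smooth_chartsD(5)[OF c(2)] by auto
  ultimately have o: "openin (mtop M) (U \<inter> f -` V)" by simp
  have "smooth_on (\<phi> ` (U \<inter> f -` V)) (\<psi> \<circ> f \<circ> inv_into U \<phi>)"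
    using f c(1) d(1) by (auto simp: smooth_map_def)
  then show ?thesis
    using c(3) d(3) by (intro smooth_atI[OF c(2) d(2) o]) auto
qed

lemma smooth_at_imp_smooth_map:
  assumes M: "smooth_atlas M" and N: "smooth_atlas N" and f: "\<And>x. x \<in> points M \<Longrightarrow> smooth_at M N f x"
  shows "smooth_map M N f"
  unfolding smooth_map_def
proof (intro conjI ballI, goal_cases)
  case 1
  show ?case
    unfolding continuous_map_def
    using openin_preimage_smooth_at[OF f openin_topspace] smooth_at_in_points(2)[OF f] by blast
next
  case (2 c)
  obtain U \<phi> where c: "c = (U, \<phi>)" by fastforce
  have c': "(U, \<phi>) \<in> smooth_charts M"
    using 2 c atlas_subset_smooth_charts[OF M] by auto
  show ?case
    unfolding c
  proof (clarify)
    fix V \<psi> assume "(V, \<psi>) \<in> atlas N"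
    then have d: "(V, \<psi>) \<in> smooth_charts N"
      using atlas_subset_smooth_charts[OF N] by auto
    let ?S = "\<phi> ` (U \<inter> f -` V)"
    show "smooth_on ?S (\<psi> \<circ> f \<circ> inv_into U \<phi>)"
    proof (rule smooth_on_local)
      fix z assume "z \<in> ?S"
      then obtain x where x: "x \<in> U" "f x \<in> V" "z = \<phi> x" by blast
      have fx: "smooth_at M N f x"
        using x(1) f smooth_chartsD(5)[OF c'] by blast
      then obtain D where D: "openin (mtop M) D" "x \<in> D" "D \<subseteq> U" "f ` D \<subseteq> V"
        "smooth_on (\<phi> ` D) (\<psi> \<circ> f \<circ> inv_into U \<phi>)"
        using smooth_at_chartsE[OF M N fx c' x(1) d x(2)] by metis
      have "\<phi> ` D \<subseteq> ?S"
        by (rule image_mono) (use D(3,4) in blast)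
      then have "openin (top_of_set ?S) (\<phi> ` D)"
        by (rule openin_subset_trans[OF is_chart_image_openin[OF smooth_charts_is_chart[OF c'] D(1,3)]])
           (use smooth_chartsD(4)[OF c'] in auto)
      then show "\<exists>T. openin (top_of_set ?S) T \<and> z \<in> T \<and> smooth_on T (\<psi> \<circ> f \<circ> inv_into U \<phi>)"
        using D x(3) by blast
    qed
  qed
qed

section \<open>Products, open submanifolds, embedded submanifolds and linear subspaces\<close>

lemma is_chart_prod:
  assumes c: "is_chart M (U, \<phi>)" and d: "is_chart N (V, \<psi>)"
  shows "is_chart (prod_manifold M N) (U \<times> V, map_prod \<phi> \<psi>)"
proof (rule is_chartI)
  show "openin (mtop (prod_manifold M N)) (U \<times> V)"
    using is_chartD(1)[OF c] is_chartD(1)[OF d] by (simp add: prod_manifold_def openin_prod_Times_iff)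
  show "inj_on (map_prod \<phi> \<psi>) (U \<times> V)"
    using is_chartD(3)[OF c] is_chartD(3)[OF d] by (rule map_prod_inj_on)
next
  fix A assume A: "openin (mtop (prod_manifold M N)) A" "A \<subseteq> U \<times> V"
  show "openin (top_of_set (model (prod_manifold M N))) (map_prod \<phi> \<psi> ` A)"
  proof (subst openin_subopen, intro ballI)
    fix z assume "z \<in> map_prod \<phi> \<psi> ` A"
    then obtain a b where ab: "(a, b) \<in> A" "z = (\<phi> a, \<psi> b)" by auto
    obtain A1 A2 where A12: "openin (mtop M) A1" "openin (mtop N) A2" "a \<in> A1" "b \<in> A2" "A1 \<times> A2 \<subseteq> A"
      using A(1) ab(1) by (auto simp: prod_manifold_def openin_prod_topology_alt) metis
    have "A1 \<subseteq> U" "A2 \<subseteq> V"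
      using A(2) A12(3-5) by blast+
    then have "openin (top_of_set (model M)) (\<phi> ` A1)" "openin (top_of_set (model N)) (\<psi> ` A2)"
      using is_chart_image_openin[OF c A12(1)] is_chart_image_openin[OF d A12(2)] by blast+
    then have "openin (top_of_set (model M \<times> model N)) (\<phi> ` A1 \<times> \<psi> ` A2)"
      by (rule openin_Times)
    then show "\<exists>T. openin (top_of_set (model (prod_manifold M N))) T \<and> z \<in> T \<and> T \<subseteq> map_prod \<phi> \<psi> ` A"
      using ab(2) A12(3-5) by (intro exI[of _ "\<phi> ` A1 \<times> \<psi> ` A2"]) (force simp: prod_manifold_def)
  qed
next
  fix T :: "('b \<times> 'd) set" assume T: "open T"
  show "openin (mtop (prod_manifold M N)) {x \<in> U \<times> V. map_prod \<phi> \<psi> x \<in> T}"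
  proof (subst openin_subopen, intro ballI)
    fix x assume x: "x \<in> {x \<in> U \<times> V. map_prod \<phi> \<psi> x \<in> T}"
    then obtain T1 T2 where t: "open T1" "open T2" "map_prod \<phi> \<psi> x \<in> T1 \<times> T2" "T1 \<times> T2 \<subseteq> T"
      using open_prod_elim[OF T] by blast
    let ?A = "{a\<in>U. \<phi> a \<in> T1} \<times> {b\<in>V. \<psi> b \<in> T2}"
    have "openin (mtop (prod_manifold M N)) ?A"
      using is_chart_vimage_openin[OF c t(1)] is_chart_vimage_openin[OF d t(2)]
      by (simp add: prod_manifold_def openin_prod_Times_iff)
    then show "\<exists>S. openin (mtop (prod_manifold M N)) S \<and> x \<in> S \<and> S \<subseteq> {x \<in> U \<times> V. map_prod \<phi> \<psi> x \<in> T}"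
      using x t by (intro exI[of _ ?A]) auto
  qed
qed

lemma smooth_on_chart_change_prod:
  assumes "smooth_on (\<phi> ` (U \<inter> U')) (\<phi>' \<circ> inv_into U \<phi>)" "smooth_on (\<psi> ` (V \<inter> V')) (\<psi>' \<circ> inv_into V \<psi>)"
    and "inj_on \<phi> U" "inj_on \<psi> V"
  shows "smooth_on (map_prod \<phi> \<psi> ` (U \<times> V \<inter> U' \<times> V')) (map_prod \<phi>' \<psi>' \<circ> inv_into (U \<times> V) (map_prod \<phi> \<psi>))"
proof -
  let ?S = "map_prod \<phi> \<psi> ` (U \<times> V \<inter> U' \<times> V')"
  have "smooth_on ?S (\<lambda>z. (((\<phi>' \<circ> inv_into U \<phi>) \<circ> fst) z, ((\<psi>' \<circ> inv_into V \<psi>) \<circ> snd) z))"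
    by (intro smooth_on_Pair smooth_on_compose[OF smooth_on_linear[OF linear_fst] assms(1)]
        smooth_on_compose[OF smooth_on_linear[OF linear_snd] assms(2)]) auto
  then show ?thesis
  proof (rule smooth_on_cong)
    fix z assume "z \<in> ?S"
    then obtain a b where ab: "a \<in> U" "b \<in> V" "z = map_prod \<phi> \<psi> (a, b)" by auto
    have "inv_into (U \<times> V) (map_prod \<phi> \<psi>) z = (a, b)"
      unfolding ab(3) using ab assms(3,4) by (intro inv_into_f_f map_prod_inj_on) auto
    then show "(((\<phi>' \<circ> inv_into U \<phi>) \<circ> fst) z, ((\<psi>' \<circ> inv_into V \<psi>) \<circ> snd) z) =
        (map_prod \<phi>' \<psi>' \<circ> inv_into (U \<times> V) (map_prod \<phi> \<psi>)) z"
      using ab assms(3,4) by simp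
  qed
qed

lemma points_prod_manifold [simp]: "points (prod_manifold M N) = points M \<times> points N"
  by (simp add: prod_manifold_def)

lemma model_prod_manifold [simp]: "model (prod_manifold M N) = model M \<times> model N"
  by (simp add: prod_manifold_def)

lemma smooth_atlas_prod_manifold:
  assumes M: "smooth_atlas M" and N: "smooth_atlas N"
  shows "smooth_atlas (prod_manifold M N)"
  unfolding smooth_atlas_def
proof (intro conjI ballI)
  show "subspace (model (prod_manifold M N))"
    using M N by (auto simp: smooth_atlas_def intro: subspace_Times)
  fix c assume "c \<in> atlas (prod_manifold M N)"
  then obtain U \<phi> V \<psi> where c: "(U, \<phi>) \<in> atlas M" "(V, \<psi>) \<in> atlas N" "c = (U \<times> V, map_prod \<phi> \<psi>)"
    by (auto simp: prod_manifold_def)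
  have ic: "is_chart M (U, \<phi>)" "is_chart N (V, \<psi>)"
    using c M N by (auto simp: smooth_atlas_def)
  then show "is_chart (prod_manifold M N) c"
    unfolding c(3) by (rule is_chart_prod)
  fix d assume "d \<in> atlas (prod_manifold M N)"
  then obtain U' \<phi>' V' \<psi>' where d: "(U', \<phi>') \<in> atlas M" "(V', \<psi>') \<in> atlas N" "d = (U' \<times> V', map_prod \<phi>' \<psi>')"
    by (auto simp: prod_manifold_def)
  have id: "is_chart M (U', \<phi>')" "is_chart N (V', \<psi>')"
    using d M N by (auto simp: smooth_atlas_def)
  have "compatible (U, \<phi>) (U', \<phi>')" "compatible (V, \<psi>) (V', \<psi>')"
    using c d M N by (auto simp: smooth_atlas_def)
  then have co: "smooth_on (\<phi> ` (U \<inter> U')) (\<phi>' \<circ> inv_into U \<phi>)" "smooth_on (\<psi> ` (V \<inter> V')) (\<psi>' \<circ> inv_into V \<psi>)"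
    "smooth_on (\<phi>' ` (U' \<inter> U)) (\<phi> \<circ> inv_into U' \<phi>')" "smooth_on (\<psi>' ` (V' \<inter> V)) (\<psi> \<circ> inv_into V' \<psi>')"
    by (simp_all add: compatible_def Int_commute)
  show "compatible c d"
    unfolding c(3) d(3) compatible_def
    using smooth_on_chart_change_prod[OF co(1,2) is_chartD(3)[OF ic(1)] is_chartD(3)[OF ic(2)]]
      smooth_on_chart_change_prod[OF co(3,4) is_chartD(3)[OF id(1)] is_chartD(3)[OF id(2)]]
    by (simp add: Int_commute)
next
  show "\<Union>(fst ` atlas (prod_manifold M N)) = points (prod_manifold M N)"
  proof
    show "\<Union>(fst ` atlas (prod_manifold M N)) \<subseteq> points (prod_manifold M N)"
    proof (rule Union_least)
      fix S assume "S \<in> fst ` atlas (prod_manifold M N)"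
      then obtain U \<phi> V \<psi> where c: "(U, \<phi>) \<in> atlas M" "(V, \<psi>) \<in> atlas N" "S = U \<times> V"
        by (auto simp: prod_manifold_def)
      then have "U \<subseteq> points M" "V \<subseteq> points N"
        using smooth_chartsD(5) atlas_subset_smooth_charts[OF M] atlas_subset_smooth_charts[OF N] by blast+
      then show "S \<subseteq> points (prod_manifold M N)"
        using c(3) by auto
    qed
    show "points (prod_manifold M N) \<subseteq> \<Union>(fst ` atlas (prod_manifold M N))"
    proof
      fix x assume "x \<in> points (prod_manifold M N)"
      then have fstx: "fst x \<in> points M" and sndx: "snd x \<in> points N"
        by auto
      obtain U \<phi> where c: "(U, \<phi>) \<in> atlas M" "fst x \<in> U"
        using atlas_chartE[OF M fstx] by metis
      obtain V \<psi> where d: "(V, \<psi>) \<in> atlas N" "snd x \<in> V"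
        using atlas_chartE[OF N sndx] by metis
      have "(U \<times> V, map_prod \<phi> \<psi>) \<in> atlas (prod_manifold M N)"
        using c d by (auto simp: prod_manifold_def)
      moreover have "x \<in> U \<times> V"
        using c(2) d(2) by (simp add: mem_Times_iff)
      ultimately show "x \<in> \<Union>(fst ` atlas (prod_manifold M N))"
        by (metis UnionI fst_conv imageI)
    qed
  qed
qed

lemma atlas_chart_prodE:
  assumes M: "smooth_atlas M" and N: "smooth_atlas N" and "a \<in> points M" "b \<in> points N"
  obtains U \<phi> V \<psi> where "(U, \<phi>) \<in> smooth_charts M" "(V, \<psi>) \<in> smooth_charts N" "a \<in> U" "b \<in> V"
    "(U \<times> V, map_prod \<phi> \<psi>) \<in> smooth_charts (prod_manifold M N)"
proof -
  obtain U \<phi> where c: "(U, \<phi>) \<in> atlas M" "(U, \<phi>) \<in> smooth_charts M" "a \<in> U"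
    using atlas_chartE[OF M] assms by metis
  obtain V \<psi> where d: "(V, \<psi>) \<in> atlas N" "(V, \<psi>) \<in> smooth_charts N" "b \<in> V"
    using atlas_chartE[OF N] assms by metis
  have "(U \<times> V, map_prod \<phi> \<psi>) \<in> atlas (prod_manifold M N)"
    using c d by (auto simp: prod_manifold_def)
  then show ?thesis
    using atlas_subset_smooth_charts[OF smooth_atlas_prod_manifold[OF M N]]
    by (intro that[OF c(2) d(2) c(3) d(3)]) (rule subsetD)
qed

lemma smooth_at_fst:
  assumes M: "smooth_atlas M" and N: "smooth_atlas N" and x: "x \<in> points (prod_manifold M N)"
  shows "smooth_at (prod_manifold M N) M fst x"
proof -
  have xM: "fst x \<in> points M" and xN: "snd x \<in> points N"
    using x by auto
  obtain U \<phi> V \<psi> where c: "(U, \<phi>) \<in> smooth_charts M" "(V, \<psi>) \<in> smooth_charts N" "fst x \<in> U"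
      "snd x \<in> V" "(U \<times> V, map_prod \<phi> \<psi>) \<in> smooth_charts (prod_manifold M N)"
    by (rule atlas_chart_prodE[OF M N xM xN])
  show ?thesis
  proof (rule smooth_atI[OF c(5) c(1) smooth_chartsD(1)[OF c(5)]])
    show "smooth_on (map_prod \<phi> \<psi> ` (U \<times> V)) (\<phi> \<circ> fst \<circ> inv_into (U \<times> V) (map_prod \<phi> \<psi>))"
    proof (rule smooth_on_cong[OF smooth_on_linear[OF linear_fst]])
      fix z assume "z \<in> map_prod \<phi> \<psi> ` (U \<times> V)"
      then obtain y where "z = map_prod \<phi> \<psi> y" "y \<in> U \<times> V" by (rule imageE)
      then show "fst z = (\<phi> \<circ> fst \<circ> inv_into (U \<times> V) (map_prod \<phi> \<psi>)) z"
        using c(5) by (simp add: fst_map_prod)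
    qed
  qed (use c(3,4) in \<open>auto simp: mem_Times_iff\<close>)
qed

lemma smooth_at_snd:
  assumes M: "smooth_atlas M" and N: "smooth_atlas N" and x: "x \<in> points (prod_manifold M N)"
  shows "smooth_at (prod_manifold M N) N snd x"
proof -
  have xM: "fst x \<in> points M" and xN: "snd x \<in> points N"
    using x by auto
  obtain U \<phi> V \<psi> where c: "(U, \<phi>) \<in> smooth_charts M" "(V, \<psi>) \<in> smooth_charts N" "fst x \<in> U"
      "snd x \<in> V" "(U \<times> V, map_prod \<phi> \<psi>) \<in> smooth_charts (prod_manifold M N)"
    by (rule atlas_chart_prodE[OF M N xM xN])
  show ?thesis
  proof (rule smooth_atI[OF c(5) c(2) smooth_chartsD(1)[OF c(5)]])
    show "smooth_on (map_prod \<phi> \<psi> ` (U \<times> V)) (\<psi> \<circ> snd \<circ> inv_into (U \<times> V) (map_prod \<phi> \<psi>))"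
    proof (rule smooth_on_cong[OF smooth_on_linear[OF linear_snd]])
      fix z assume "z \<in> map_prod \<phi> \<psi> ` (U \<times> V)"
      then obtain y where "z = map_prod \<phi> \<psi> y" "y \<in> U \<times> V" by (rule imageE)
      then show "snd z = (\<psi> \<circ> snd \<circ> inv_into (U \<times> V) (map_prod \<phi> \<psi>)) z"
        using c(5) by (simp add: snd_map_prod)
    qed
  qed (use c(3,4) in \<open>auto simp: mem_Times_iff\<close>)
qed

text \<open>Together with the projections this is the universal property of the product, through which all
  maps into products are handled below.\<close>

lemma smooth_at_Pair:
  assumes L: "smooth_atlas L" and M: "smooth_atlas M" and N: "smooth_atlas N"
    and f: "smooth_at L M f x" and g: "smooth_at L N g x"
  shows "smooth_at L (prod_manifold M N) (\<lambda>y. (f y, g y)) x"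
proof -
  obtain W \<eta> where w: "(W, \<eta>) \<in> smooth_charts L" "x \<in> W"
    using atlas_chartE[OF L smooth_at_in_points(1)[OF f]] by metis
  obtain U \<phi> V \<psi> where c: "(U, \<phi>) \<in> smooth_charts M" "(V, \<psi>) \<in> smooth_charts N" "f x \<in> U" "g x \<in> V"
      "(U \<times> V, map_prod \<phi> \<psi>) \<in> smooth_charts (prod_manifold M N)"
    by (rule atlas_chart_prodE[OF M N smooth_at_in_points(2)[OF f] smooth_at_in_points(2)[OF g]])
  obtain D where D: "openin (mtop L) D" "x \<in> D" "D \<subseteq> W" "f ` D \<subseteq> U"
      "smooth_on (\<eta> ` D) (\<phi> \<circ> f \<circ> inv_into W \<eta>)"
    by (rule smooth_at_chartsE[OF L M f w c(1,3)])
  obtain E where E: "openin (mtop L) E" "x \<in> E" "E \<subseteq> W" "g ` E \<subseteq> V"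
      "smooth_on (\<eta> ` E) (\<psi> \<circ> g \<circ> inv_into W \<eta>)"
    by (rule smooth_at_chartsE[OF L N g w c(2,4)])
  have "smooth_on (\<eta> ` (D \<inter> E)) (\<lambda>z. ((\<phi> \<circ> f \<circ> inv_into W \<eta>) z, (\<psi> \<circ> g \<circ> inv_into W \<eta>) z))"
    by (intro smooth_on_Pair smooth_on_subset[OF D(5)] smooth_on_subset[OF E(5)]) auto
  then have "smooth_on (\<eta> ` (D \<inter> E)) (map_prod \<phi> \<psi> \<circ> (\<lambda>y. (f y, g y)) \<circ> inv_into W \<eta>)"
    by (rule smooth_on_cong) simp
  then show ?thesis
    using D E by (intro smooth_atI[OF w(1) c(5), of "D \<inter> E"]) auto
qed

lemma compatible_restrict:
  assumes "smooth_atlas M" "(U, \<phi>) \<in> smooth_charts M" "(V, \<psi>) \<in> smooth_charts M" "U' \<subseteq> U" "V' \<subseteq> V"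
  shows "compatible (U', \<phi>) (V', \<psi>)"
proof -
  have *: "smooth_on (\<phi> ` (U' \<inter> V')) (\<psi> \<circ> inv_into U' \<phi>)"
    if "(U, \<phi>) \<in> smooth_charts M" "(V, \<psi>) \<in> smooth_charts M" "U' \<subseteq> U" "V' \<subseteq> V" for U V U' V' \<phi> \<psi>
  proof (rule smooth_on_cong_subset[OF smooth_charts_compatible[OF assms(1) that(1,2)]])
    fix z assume "z \<in> \<phi> ` (U' \<inter> V')"
    then obtain x where x: "x \<in> U'" "z = \<phi> x" by blast
    have "inj_on \<phi> U'"
      using smooth_chartsD(3)[OF that(1)] that(3) inj_on_subset by blast
    then have "inv_into U' \<phi> z = inv_into U \<phi> z"
      using x that(1,3) by auto
    then show "(\<psi> \<circ> inv_into U \<phi>) z = (\<psi> \<circ> inv_into U' \<phi>) z" by simp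
  qed (use that in auto)
  show ?thesis
    using *[OF assms(2-5)] *[OF assms(3,2,5,4)] by (simp add: compatible_def Int_commute)
qed

lemma points_open_submanifold:
  "openin (mtop M) S \<Longrightarrow> points (open_submanifold M S) = S"
  using openin_subset by (fastforce simp: open_submanifold_def)

lemma smooth_atlas_open_submanifold:
  assumes M: "smooth_atlas M" and S: "openin (mtop M) S"
  shows "smooth_atlas (open_submanifold M S)"
  unfolding smooth_atlas_def
proof (intro conjI ballI)
  show "subspace (model (open_submanifold M S))"
    using M by (simp add: smooth_atlas_def open_submanifold_def)
  fix c assume "c \<in> atlas (open_submanifold M S)"
  then obtain U \<phi> where c: "(U, \<phi>) \<in> smooth_charts M" "c = (U \<inter> S, \<phi>)"
    using atlas_subset_smooth_charts[OF M] by (auto simp: open_submanifold_def)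
  show "is_chart (open_submanifold M S) c"
    unfolding c(2)
  proof (rule is_chartI)
    show "openin (mtop (open_submanifold M S)) (U \<inter> S)"
      using smooth_chartsD(1)[OF c(1)] by (auto simp: open_submanifold_def openin_subtopology_Int)
    show "inj_on \<phi> (U \<inter> S)"
      using smooth_chartsD(3)[OF c(1)] inj_on_subset by blast
    show "openin (top_of_set (model (open_submanifold M S))) (\<phi> ` A)"
      if "openin (mtop (open_submanifold M S)) A" "A \<subseteq> U \<inter> S" for A
      using that is_chart_image_openin[OF smooth_charts_is_chart[OF c(1)], of A]
        openin_open_subtopology[OF S] by (auto simp: open_submanifold_def)
    show "openin (mtop (open_submanifold M S)) {x \<in> U \<inter> S. \<phi> x \<in> T}" if "open T" for T
      using is_chart_vimage_openin[OF smooth_charts_is_chart[OF c(1)] that] S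
      by (auto simp: open_submanifold_def openin_open_subtopology
          intro!: openin_Int[of _ "{x\<in>U. \<phi> x \<in> T}" S, THEN back_subst[of "openin (mtop M)"]])
  qed
  fix d assume "d \<in> atlas (open_submanifold M S)"
  then obtain V \<psi> where d: "(V, \<psi>) \<in> smooth_charts M" "d = (V \<inter> S, \<psi>)"
    using atlas_subset_smooth_charts[OF M] by (auto simp: open_submanifold_def)
  show "compatible c d"
    unfolding c(2) d(2) by (rule compatible_restrict[OF M c(1) d(1)]) auto
next
  have "\<Union>(fst ` atlas M) = points M"
    using M by (simp add: smooth_atlas_def)
  moreover have "\<Union>(fst ` atlas (open_submanifold M S)) = \<Union>(fst ` atlas M) \<inter> S"
    by (force simp: open_submanifold_def)
  ultimately show "\<Union>(fst ` atlas (open_submanifold M S)) = points (open_submanifold M S)"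
    by (simp add: open_submanifold_def)
qed

text \<open>Since the inclusion and its inverse are smooth, smoothness of maps from and to open
  submanifolds reduces to smoothness in the ambient manifolds.\<close>

lemma smooth_at_open_submanifold_inclusion:
  assumes M: "smooth_atlas M" and S: "openin (mtop M) S" and x: "x \<in> S"
  shows "smooth_at (open_submanifold M S) M (\<lambda>y. y) x" "smooth_at M (open_submanifold M S) (\<lambda>y. y) x"
proof -
  obtain U \<phi> where c: "(U, \<phi>) \<in> atlas M" "(U, \<phi>) \<in> smooth_charts M" "x \<in> U"
    using atlas_chartE[OF M] x openin_subset[OF S] by blast
  have "(U \<inter> S, \<phi>) \<in> atlas (open_submanifold M S)"
    using c(1) by (auto simp: open_submanifold_def)
  then have d: "(U \<inter> S, \<phi>) \<in> smooth_charts (open_submanifold M S)"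
    using atlas_subset_smooth_charts[OF smooth_atlas_open_submanifold[OF M S]] by blast
  have r: "smooth_on (\<phi> ` (U \<inter> S)) (\<phi> \<circ> (\<lambda>y. y) \<circ> inv_into (U \<inter> S) \<phi>)"
    "smooth_on (\<phi> ` (U \<inter> S)) (\<phi> \<circ> (\<lambda>y. y) \<circ> inv_into U \<phi>)"
    by (rule smooth_on_cong[OF smooth_on_linear[OF linear_id]], use c(2) d in auto)+
  show "smooth_at (open_submanifold M S) M (\<lambda>y. y) x"
    by (rule smooth_atI[OF d c(2) smooth_chartsD(1)[OF d] _ _ _ r(1)]) (use c x in auto)
  show "smooth_at M (open_submanifold M S) (\<lambda>y. y) x"
    by (rule smooth_atI[OF c(2) d _ _ _ _ r(2)]) (use c x S smooth_chartsD(1)[OF c(2)] in auto)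
qed

lemma smooth_at_open_submanifold:
  assumes M: "smooth_atlas M" and S: "openin (mtop M) S" and x: "x \<in> S"
  shows "smooth_at (open_submanifold M S) N f x \<longleftrightarrow> smooth_at M N f x"
  using smooth_at_open_submanifold_inclusion[OF assms] smooth_atlas_open_submanifold[OF M S] M
    smooth_at_compose[of "open_submanifold M S" M "\<lambda>y. y" x N f]
    smooth_at_compose[of M "open_submanifold M S" "\<lambda>y. y" x N f] by blast

lemma smooth_at_into_open_submanifold:
  assumes M: "smooth_atlas M" and N: "smooth_atlas N" and T: "openin (mtop N) T"
  shows "smooth_at M (open_submanifold N T) f x \<longleftrightarrow> smooth_at M N f x \<and> f x \<in> T"
proof
  assume *: "smooth_at M (open_submanifold N T) f x"
  then have fx: "f x \<in> T"
    using smooth_at_in_points(2) points_open_submanifold[OF T] by metis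
  show "smooth_at M N f x \<and> f x \<in> T"
    using smooth_at_compose[OF M smooth_atlas_open_submanifold[OF N T] *
        smooth_at_open_submanifold_inclusion(1)[OF N T fx]] fx by simp
next
  assume "smooth_at M N f x \<and> f x \<in> T"
  then show "smooth_at M (open_submanifold N T) f x"
    using smooth_at_compose[OF M N _ smooth_at_open_submanifold_inclusion(2)[OF N T], of f x] by simp
qed

lemma smooth_map_open_submanifold_iff:
  assumes M: "smooth_atlas M" and N: "smooth_atlas N" and S: "openin (mtop M) S"
  shows "smooth_map (open_submanifold M S) N f \<longleftrightarrow> (\<forall>x\<in>S. smooth_at M N f x)"
  using smooth_map_imp_smooth_at[OF smooth_atlas_open_submanifold[OF M S] N]
    smooth_at_imp_smooth_map[OF smooth_atlas_open_submanifold[OF M S] N]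
    smooth_at_open_submanifold[OF M S] points_open_submanifold[OF S] by metis

lemma slice_charts_subset: "slice_charts M S W \<subseteq> smooth_charts M"
  by (auto simp: slice_charts_def)

text \<open>The images of relatively open sets under a slice chart are open in \<open>W\<close> because the chart maps
  the part of its domain in \<open>S\<close> exactly onto the part of its image in \<open>W\<close>.\<close>

lemma smooth_atlas_submanifold:
  assumes M: "smooth_atlas M" and S: "embedded_submanifold M S W"
  shows "smooth_atlas (submanifold M S W)"
  unfolding smooth_atlas_def
proof (intro conjI ballI)
  show "subspace (model (submanifold M S W))"
    using S by (simp add: embedded_submanifold_def submanifold_def)
  fix c assume "c \<in> atlas (submanifold M S W)"
  then obtain U \<phi> where c': "(U, \<phi>) \<in> slice_charts M S W" "c = (U \<inter> S, \<phi>)"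
    by (auto simp: submanifold_def)
  then have c: "(U, \<phi>) \<in> smooth_charts M" "\<phi> ` (U \<inter> S) = \<phi> ` U \<inter> W"
    by (auto simp: slice_charts_def)
  show "is_chart (submanifold M S W) c"
    unfolding c'(2)
  proof (rule is_chartI)
    show "openin (mtop (submanifold M S W)) (U \<inter> S)"
      using smooth_chartsD(1)[OF c(1)] by (auto simp: submanifold_def openin_subtopology_Int)
    show "inj_on \<phi> (U \<inter> S)"
      using smooth_chartsD(3)[OF c(1)] inj_on_subset by blast
    show "openin (top_of_set (model (submanifold M S W))) (\<phi> ` A)"
      if A: "openin (mtop (submanifold M S W)) A" "A \<subseteq> U \<inter> S" for A
    proof -
      obtain A' where A': "openin (mtop M) A'" "A = A' \<inter> S"
        using A(1) by (auto simp: submanifold_def openin_subtopology)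
      have "openin (top_of_set (model M)) (\<phi> ` (A' \<inter> U))"
        using A'(1) smooth_chartsD(1)[OF c(1)]
        by (intro is_chart_image_openin[OF smooth_charts_is_chart[OF c(1)]]) auto
      then obtain Z where Z: "open Z" "\<phi> ` (A' \<inter> U) = model M \<inter> Z"
        by (auto simp: openin_open)
      have "\<phi> ` A = \<phi> ` (A' \<inter> U) \<inter> \<phi> ` (U \<inter> S)"
        using A(2) A'(2) smooth_chartsD(3)[OF c(1)] by (auto dest: inj_onD)
      also have "\<dots> = W \<inter> Z"
        using Z(2) c(2) S by (auto simp: embedded_submanifold_def)
      finally show ?thesis
        using Z(1) by (auto simp: submanifold_def openin_open)
    qed
    show "openin (mtop (submanifold M S W)) {x \<in> U \<inter> S. \<phi> x \<in> T}" if "open T" for T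
    proof -
      have "{x \<in> U \<inter> S. \<phi> x \<in> T} = {x\<in>U. \<phi> x \<in> T} \<inter> S" by auto
      then show ?thesis
        using is_chart_vimage_openin[OF smooth_charts_is_chart[OF c(1)] that]
        by (auto simp: submanifold_def openin_subtopology_Int)
    qed
  qed
  fix d assume "d \<in> atlas (submanifold M S W)"
  then obtain V \<psi> where d: "(V, \<psi>) \<in> smooth_charts M" "d = (V \<inter> S, \<psi>)"
    using slice_charts_subset[of M S W] by (auto simp: submanifold_def)
  show "compatible c d"
    unfolding c'(2) d(2) by (rule compatible_restrict[OF M c(1) d(1)]) auto
next
  have "\<Union>(fst ` atlas (submanifold M S W)) = \<Union>(fst ` slice_charts M S W) \<inter> S"
    by (force simp: submanifold_def)
  also have "\<dots> = S"
    using S by (force simp: embedded_submanifold_def)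
  also have "\<dots> = points (submanifold M S W)"
    using S by (auto simp: embedded_submanifold_def submanifold_def)
  finally show "\<Union>(fst ` atlas (submanifold M S W)) = points (submanifold M S W)" .
qed

lemma points_submanifold: "embedded_submanifold M S W \<Longrightarrow> points (submanifold M S W) = S"
  by (auto simp: embedded_submanifold_def submanifold_def)

lemma slice_chartE:
  assumes "smooth_atlas M" "embedded_submanifold M S W" "x \<in> S"
  obtains U \<phi> where "(U, \<phi>) \<in> smooth_charts M" "(U \<inter> S, \<phi>) \<in> smooth_charts (submanifold M S W)" "x \<in> U"
proof -
  obtain U \<phi> where c: "(U, \<phi>) \<in> slice_charts M S W" "x \<in> U"
    using assms(2,3) by (auto simp: embedded_submanifold_def)
  then have "(U \<inter> S, \<phi>) \<in> atlas (submanifold M S W)"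
    by (auto simp: submanifold_def)
  then show ?thesis
    using that c slice_charts_subset atlas_subset_smooth_charts[OF smooth_atlas_submanifold[OF assms(1,2)]]
    by (metis subsetD)
qed

lemma smooth_at_submanifold_inclusion:
  assumes M: "smooth_atlas M" and S: "embedded_submanifold M S W" and x: "x \<in> S"
  shows "smooth_at (submanifold M S W) M (\<lambda>y. y) x"
proof -
  obtain U \<phi> where c: "(U, \<phi>) \<in> smooth_charts M" "(U \<inter> S, \<phi>) \<in> smooth_charts (submanifold M S W)" "x \<in> U"
    by (rule slice_chartE[OF assms])
  have r: "smooth_on (\<phi> ` (U \<inter> S)) (\<phi> \<circ> (\<lambda>y. y) \<circ> inv_into (U \<inter> S) \<phi>)"
    by (rule smooth_on_cong[OF smooth_on_linear[OF linear_id]]) (use c in auto)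
  show ?thesis
    by (rule smooth_atI[OF c(2,1) smooth_chartsD(1)[OF c(2)] _ _ _ r]) (use c x in auto)
qed

text \<open>A smooth map with values in an embedded submanifold is smooth into it, because a slice
  chart serves as a chart of both manifolds.\<close>

lemma smooth_at_into_submanifold:
  assumes M: "smooth_atlas M" and N: "smooth_atlas N" and S: "embedded_submanifold N S W"
    and f: "smooth_at M N f x" and A: "openin (mtop M) A" "x \<in> A" "f ` A \<subseteq> S"
  shows "smooth_at M (submanifold N S W) f x"
proof -
  obtain V \<psi> where d: "(V, \<psi>) \<in> smooth_charts N" "(V \<inter> S, \<psi>) \<in> smooth_charts (submanifold N S W)" "f x \<in> V"
    using slice_chartE[OF N S, of "f x"] A by blast
  obtain U \<phi> where c: "(U, \<phi>) \<in> smooth_charts M" "x \<in> U"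
    using atlas_chartE[OF M smooth_at_in_points(1)[OF f]] by metis
  obtain D where D: "openin (mtop M) D" "x \<in> D" "D \<subseteq> U" "f ` D \<subseteq> V"
    "smooth_on (\<phi> ` D) (\<psi> \<circ> f \<circ> inv_into U \<phi>)"
    by (rule smooth_at_chartsE[OF M N f c d(1,3)])
  have "smooth_on (\<phi> ` (D \<inter> A)) (\<psi> \<circ> f \<circ> inv_into U \<phi>)"
    by (rule smooth_on_subset[OF D(5)]) auto
  then show ?thesis
    using D A by (intro smooth_atI[OF c(1) d(2), of "D \<inter> A"]) auto
qed

text \<open>With linear subspaces as manifolds, charts become smooth maps, and statements about transition
  maps become statements about compositions.\<close>

definition linear_manifold :: "'e::euclidean_space set \<Rightarrow> ('e, 'e) manifold" where
  "linear_manifold E = \<lparr>mtop = top_of_set E, model = E, atlas = {(E, id)}\<rparr>"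

lemma linear_manifold_simps [simp]:
  "mtop (linear_manifold E) = top_of_set E" "model (linear_manifold E) = E"
  by (simp_all add: linear_manifold_def)

lemma smooth_atlas_linear_manifold:
  assumes "subspace E"
  shows "smooth_atlas (linear_manifold E)" "(E, id) \<in> smooth_charts (linear_manifold E)"
proof -
  have "is_chart (linear_manifold E) (E, id)"
    by (rule is_chartI) (auto simp: openin_open)
  moreover have "smooth_on E (inv_into E id)"
    by (rule smooth_on_cong[OF smooth_on_linear[OF linear_id]]) (simp add: inv_into_f_f)
  ultimately show "smooth_atlas (linear_manifold E)"
    using assms by (simp add: smooth_atlas_def linear_manifold_def compatible_def)
  then show "(E, id) \<in> smooth_charts (linear_manifold E)"
    using atlas_subset_smooth_charts by (fastforce simp: linear_manifold_def)
qed

lemma smooth_at_linear_manifoldI: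
  assumes "subspace E" "subspace F" "openin (top_of_set E) S" "smooth_on S f" "f ` S \<subseteq> F" "x \<in> S"
  shows "smooth_at (linear_manifold E) (linear_manifold F) f x"
proof (rule smooth_atI[OF smooth_atlas_linear_manifold(2)[OF assms(1)] smooth_atlas_linear_manifold(2)[OF assms(2)], of S])
  have SE: "S \<subseteq> E"
    using openin_subset[OF assms(3)] by simp
  show "smooth_on (id ` S) (id \<circ> f \<circ> inv_into E id)"
  proof (rule smooth_on_cong)
    show "smooth_on (id ` S) f" using assms(4) by simp
    show "f z = (id \<circ> f \<circ> inv_into E id) z" if "z \<in> id ` S" for z
      using that SE inv_into_f_f[of id E z] by auto
  qed
qed (use assms openin_subset[OF assms(3)] in auto)

lemma smooth_at_linear_manifold_imp_smooth_on:
  assumes "subspace E" "subspace F" "\<And>x. x \<in> S \<Longrightarrow> smooth_at (linear_manifold E) (linear_manifold F) f x"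
  shows "smooth_on S f"
proof (rule smooth_on_local)
  fix x assume x: "x \<in> S"
  note E = smooth_atlas_linear_manifold[OF assms(1)] and F = smooth_atlas_linear_manifold[OF assms(2)]
  note f = assms(3)[OF x]
  have xE: "x \<in> E" "f x \<in> F"
    using smooth_at_in_points[OF f] by auto
  obtain D where D: "openin (mtop (linear_manifold E)) D" "x \<in> D" "D \<subseteq> E" "f ` D \<subseteq> F"
    "smooth_on (id ` D) (id \<circ> f \<circ> inv_into E id)"
    by (rule smooth_at_chartsE[OF E(1) F(1) f E(2) xE(1) F(2) xE(2)])
  have "smooth_on D f"
  proof (rule smooth_on_cong)
    show "smooth_on D (id \<circ> f \<circ> inv_into E id)" using D(5) by simp
    show "(id \<circ> f \<circ> inv_into E id) z = f z" if "z \<in> D" for z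
      using that D(3) inv_into_f_f[of id E z] by auto
  qed
  moreover obtain T where "open T" "D = E \<inter> T"
    using D(1) by (auto simp: openin_open)
  moreover have "S \<subseteq> E"
    using smooth_at_in_points(1)[OF assms(3)] by auto
  then have "S \<inter> D = S \<inter> T"
    using \<open>D = E \<inter> T\<close> by blast
  ultimately show "\<exists>U. openin (top_of_set S) U \<and> x \<in> U \<and> smooth_on U f"
    using D(2) x smooth_on_subset[of D f "S \<inter> D"] by (intro exI[of _ "S \<inter> D"]) (auto simp: openin_open)
qed

lemma smooth_at_chart:
  assumes "smooth_atlas M" "(U, \<phi>) \<in> smooth_charts M" "x \<in> U"
  shows "smooth_at M (linear_manifold (model M)) \<phi> x"
proof (rule smooth_atI[OF assms(2) smooth_atlas_linear_manifold(2)[of "model M"] smooth_chartsD(1)[OF assms(2)]])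
  show "smooth_on (\<phi> ` U) (id \<circ> \<phi> \<circ> inv_into U \<phi>)"
    by (rule smooth_on_cong[OF smooth_on_linear[OF linear_id]]) (use assms(2) in auto)
  show "\<phi> ` U \<subseteq> model M"
    by (rule smooth_chartsD(4)[OF assms(2)])
qed (use assms in \<open>auto simp: smooth_atlas_def\<close>)

lemma smooth_at_inv_chart:
  assumes "smooth_atlas M" "(U, \<phi>) \<in> smooth_charts M" "y \<in> \<phi> ` U"
  shows "smooth_at (linear_manifold (model M)) M (inv_into U \<phi>) y"
proof (rule smooth_atI[OF smooth_atlas_linear_manifold(2)[of "model M"] assms(2), of "\<phi> ` U"])
  have sub: "\<phi> ` U \<subseteq> model M"
    by (rule smooth_chartsD(4)[OF assms(2)])
  show "smooth_on (id ` \<phi> ` U) (\<phi> \<circ> inv_into U \<phi> \<circ> inv_into (model M) id)"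
  proof (rule smooth_on_cong[OF smooth_on_linear[OF linear_id]])
    fix z assume z: "z \<in> id ` \<phi> ` U"
    then have "inv_into (model M) id z = z"
      using sub inv_into_f_f[of id "model M" z] by auto
    then show "id z = (\<phi> \<circ> inv_into U \<phi> \<circ> inv_into (model M) id) z"
      using z by (auto simp: f_inv_into_f)
  qed
qed (use assms smooth_chartsD(2,4)[OF assms(2)] in \<open>auto simp: smooth_atlas_def inv_into_into\<close>)

section \<open>Diffeomorphisms between open sets\<close>

text \<open>Both maps are recorded, since the relevant inverses are given by explicit formulas. Values outside
  \<open>A\<close> and \<open>C\<close> are arbitrary.\<close>

definition partial_diffeo ::
  "('a, 'e::euclidean_space) manifold \<Rightarrow> 'a set \<Rightarrow> ('b, 'f::euclidean_space) manifold \<Rightarrow> 'b set \<Rightarrow>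
   ('a \<Rightarrow> 'b) \<Rightarrow> ('b \<Rightarrow> 'a) \<Rightarrow> bool" where
  "partial_diffeo M A N C f g \<longleftrightarrow>
     openin (mtop M) A \<and> openin (mtop N) C \<and> f ` A \<subseteq> C \<and> g ` C \<subseteq> A \<and>
     (\<forall>x\<in>A. g (f x) = x \<and> smooth_at M N f x) \<and> (\<forall>y\<in>C. f (g y) = y \<and> smooth_at N M g y)"

lemma partial_diffeo_sym: "partial_diffeo M A N C f g \<Longrightarrow> partial_diffeo N C M A g f"
  by (simp add: partial_diffeo_def)

lemma partial_diffeoD:
  assumes "partial_diffeo M A N C f g"
  shows "openin (mtop M) A" "openin (mtop N) C" "\<And>x. x \<in> A \<Longrightarrow> f x \<in> C" "\<And>y. y \<in> C \<Longrightarrow> g y \<in> A"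
    "\<And>x. x \<in> A \<Longrightarrow> g (f x) = x" "\<And>y. y \<in> C \<Longrightarrow> f (g y) = y"
    "\<And>x. x \<in> A \<Longrightarrow> smooth_at M N f x" "\<And>y. y \<in> C \<Longrightarrow> smooth_at N M g y"
  using assms by (auto simp: partial_diffeo_def)

lemma partial_diffeo_compose:
  assumes M: "smooth_atlas M" and N: "smooth_atlas N" and P: "smooth_atlas P"
    and f: "partial_diffeo M A N C f g" and f': "partial_diffeo N C' P D f' g'"
  shows "partial_diffeo M {x\<in>A. f x \<in> C'} P {z\<in>D. g' z \<in> C} (\<lambda>x. f' (f x)) (\<lambda>z. g (g' z))"
proof -
  note f = partial_diffeoD[OF f] and f' = partial_diffeoD[OF f']
  show ?thesis
    unfolding partial_diffeo_def
  proof (intro conjI ballI)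
    show "openin (mtop M) {x\<in>A. f x \<in> C'}"
      by (rule openin_preimage_smooth_at[OF f(7,1) f'(1)])
    show "openin (mtop P) {z\<in>D. g' z \<in> C}"
      by (rule openin_preimage_smooth_at[OF f'(8,2) f(2)])
    show "smooth_at M P (\<lambda>x. f' (f x)) x" if "x \<in> {x\<in>A. f x \<in> C'}" for x
      using smooth_at_compose[OF M N f(7) f'(7)] that by auto
    show "smooth_at P M (\<lambda>z. g (g' z)) z" if "z \<in> {z\<in>D. g' z \<in> C}" for z
      using smooth_at_compose[OF P N f'(8) f(8)] that by auto
  qed (use f f' in auto)
qed

lemma partial_diffeo_chart:
  assumes "smooth_atlas M" "(U, \<phi>) \<in> smooth_charts M"
  shows "partial_diffeo M U (linear_manifold (model M)) (\<phi> ` U) \<phi> (inv_into U \<phi>)"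
  unfolding partial_diffeo_def
  using smooth_at_chart[OF assms] smooth_at_inv_chart[OF assms] smooth_chartsD(1,2)[OF assms(2)] assms(2)
  by (auto simp: f_inv_into_f inv_into_into)

text \<open>This produces charts without computing transition maps: each transition map to another chart is a
  composition of smooth maps.\<close>

lemma partial_diffeo_imp_chart:
  assumes M: "smooth_atlas M" and F: "partial_diffeo M D (linear_manifold (model M)) C F K"
  shows "(D, F) \<in> smooth_charts M"
proof -
  note F = partial_diffeoD[OF F]
  have E: "subspace (model M)"
    using M by (simp add: smooth_atlas_def)
  note L = smooth_atlas_linear_manifold(1)[OF E]
  have inj: "inj_on F D"
    using F(5) by (rule inj_on_inverseI)
  have inv: "inv_into D F z = K z" if "z \<in> F ` D" for z
    using that F(5) inj by (auto simp: inv_into_f_f)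
  have chart: "is_chart M (D, F)"
  proof (rule is_chartI[OF F(1) inj])
    fix A assume A: "openin (mtop M) A" "A \<subseteq> D"
    have "F ` A = {z\<in>C. K z \<in> A}"
      using A(2) F(3,5,6) by (force simp: image_iff)
    then show "openin (top_of_set (model M)) (F ` A)"
      using openin_preimage_smooth_at[OF F(8,2) A(1)] by simp
  next
    fix T :: "'b set" assume T: "open T"
    have eq: "{x\<in>D. F x \<in> T} = {x\<in>D. F x \<in> model M \<inter> T}"
      using smooth_at_in_points(2)[OF F(7)] by auto
    have o: "openin (mtop (linear_manifold (model M))) (model M \<inter> T)"
      using T by (simp add: openin_open_Int)
    show "openin (mtop M) {x\<in>D. F x \<in> T}"
      unfolding eq by (rule openin_preimage_smooth_at[OF F(7,1) o])
  qed
  have "compatible (D, F) (V, \<psi>)" if c: "(V, \<psi>) \<in> smooth_charts M" for V \<psi>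
    unfolding compatible_def prod.case
  proof (intro conjI)
    show "smooth_on (F ` (D \<inter> V)) (\<psi> \<circ> inv_into D F)"
    proof (rule smooth_at_linear_manifold_imp_smooth_on[OF E E])
      fix z assume "z \<in> F ` (D \<inter> V)"
      then obtain x where x: "x \<in> D" "x \<in> V" "z = F x" by blast
      have z: "z \<in> C" "K z \<in> V"
        using x F(3,5) by auto
      have "smooth_at (linear_manifold (model M)) (linear_manifold (model M)) (\<lambda>z. \<psi> (K z)) z"
        by (rule smooth_at_compose[OF L M F(8)[OF z(1)] smooth_at_chart[OF M c z(2)]])
      moreover have "openin (mtop (linear_manifold (model M))) (F ` D)"
        using is_chartD(2)[OF chart] by simp
      ultimately show "smooth_at (linear_manifold (model M)) (linear_manifold (model M)) (\<psi> \<circ> inv_into D F) z"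
        by (rule smooth_at_cong) (use inv x in auto)
    qed
    show "smooth_on (\<psi> ` (D \<inter> V)) (F \<circ> inv_into V \<psi>)"
    proof (rule smooth_at_linear_manifold_imp_smooth_on[OF E E])
      fix z assume "z \<in> \<psi> ` (D \<inter> V)"
      then obtain x where x: "x \<in> D" "x \<in> V" "z = \<psi> x" by blast
      have z: "z \<in> \<psi> ` V" "inv_into V \<psi> z \<in> D"
        using x c by auto
      have "smooth_at (linear_manifold (model M)) (linear_manifold (model M)) (\<lambda>z. F (inv_into V \<psi> z)) z"
        by (rule smooth_at_compose[OF L M smooth_at_inv_chart[OF M c z(1)] F(7)[OF z(2)]])
      then show "smooth_at (linear_manifold (model M)) (linear_manifold (model M)) (F \<circ> inv_into V \<psi>) z"
        by (simp add: comp_def)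
    qed
  qed
  then have "\<forall>d\<in>atlas M. compatible (D, F) d"
    using atlas_subset_smooth_charts[OF M] by fastforce
  then show ?thesis
    using chart by (simp add: smooth_charts_def)
qed

text \<open>The model spaces are only known to be locally diffeomorphic; comparing their dimensions is an
  instance of invariance of domain.\<close>

lemma partial_diffeo_linear_manifolds_dim_le:
  assumes E: "subspace E" and F: "subspace F" and A: "A \<noteq> {}"
    and f: "partial_diffeo (linear_manifold E) A (linear_manifold F) C f g"
  shows "dim E \<le> dim F"
proof (rule invariance_of_dimension_subspaces)
  note f = partial_diffeoD[OF f]
  show "openin (top_of_set E) A"
    using f(1) by simp
  show "continuous_on A f"
    by (rule smooth_on_imp_continuous_on[OF smooth_at_linear_manifold_imp_smooth_on[OF E F f(7)]])
  show "f \<in> A \<rightarrow> F"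
    using smooth_at_in_points(2)[OF f(7)] by auto
  show "inj_on f A"
    using f(5) by (rule inj_on_inverseI)
qed (use assms in auto)

lemma partial_diffeo_dim_le:
  assumes M: "smooth_atlas M" and N: "smooth_atlas N" and f: "partial_diffeo M A N C f g" and "A \<noteq> {}"
  shows "dim (model M) \<le> dim (model N)"
proof -
  obtain x where x: "x \<in> A"
    using assms(4) by blast
  note fD = partial_diffeoD[OF f]
  obtain U \<phi> where c: "(U, \<phi>) \<in> smooth_charts M" "x \<in> U"
    using atlas_chartE[OF M smooth_at_in_points(1)[OF fD(7)[OF x]]] by metis
  obtain V \<psi> where d: "(V, \<psi>) \<in> smooth_charts N" "f x \<in> V"
    using atlas_chartE[OF N smooth_at_in_points(2)[OF fD(7)[OF x]]] by metis
  have E: "subspace (model M)" "subspace (model N)"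
    using M N by (auto simp: smooth_atlas_def)
  note L = smooth_atlas_linear_manifold(1)[OF E(1)] smooth_atlas_linear_manifold(1)[OF E(2)]
  note chart = partial_diffeo_sym[OF partial_diffeo_chart[OF M c(1)]]
  show ?thesis
    by (rule partial_diffeo_linear_manifolds_dim_le[OF E _ partial_diffeo_compose[OF L(1) N L(2)
            partial_diffeo_compose[OF L(1) M N chart f] partial_diffeo_chart[OF N d(1)]]])
       (use x c d in \<open>auto intro!: exI[of _ "\<phi> x"]\<close>)
qed

lemma linear_partial_diffeo_exists:
  fixes E :: "'e::euclidean_space set" and F :: "'f::euclidean_space set"
  assumes E: "subspace E" and F: "subspace F" and "dim E = dim F"
  obtains L K where "linear L" "partial_diffeo (linear_manifold E) E (linear_manifold F) F L K"
proof -
  obtain L where L: "linear L" "L ` E = F" "inj_on L E"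
    using subspace_isomorphism[OF assms] by blast
  obtain K where K: "linear K" "\<forall>x\<in>E. K (L x) = x"
    using linear_exists_left_inverse_on[OF L(1) E L(3)] by blast
  have "partial_diffeo (linear_manifold E) E (linear_manifold F) F L K"
    unfolding partial_diffeo_def
  proof (intro conjI ballI)
    show "smooth_at (linear_manifold E) (linear_manifold F) L x" if "x \<in> E" for x
      by (rule smooth_at_linear_manifoldI[OF E F _ smooth_on_linear[OF L(1)], of E]) (use L that in auto)
    show "smooth_at (linear_manifold F) (linear_manifold E) K y" if "y \<in> F" for y
      by (rule smooth_at_linear_manifoldI[OF F E _ smooth_on_linear[OF K(1)], of F]) (use K L that in auto)
  qed (use K L in auto)
  then show ?thesis
    using that L(1) by blast
qed


section \<open>Graphs are embedded submanifolds\<close>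

lemma shear_partial_diffeo:
  assumes E: "subspace E" and F: "subspace F" and Y: "openin (top_of_set E) Y"
    and k: "smooth_on Y k" "k ` Y \<subseteq> F"
  shows "partial_diffeo (linear_manifold (E \<times> F)) (Y \<times> F) (linear_manifold (E \<times> F)) (Y \<times> F)
    (\<lambda>(u, c). (u, c - k u)) (\<lambda>(u, c). (u, c + k u))"
proof -
  have EF: "subspace (E \<times> F)"
    using E F by (rule subspace_Times)
  have o: "openin (top_of_set (E \<times> F)) (Y \<times> F)"
    using Y by (intro openin_Times) auto
  have YE: "Y \<subseteq> E"
    using openin_subset[OF Y] by simp
  have kfst: "smooth_on (Y \<times> F) (k \<circ> fst)"
    by (rule smooth_on_compose[OF smooth_on_linear[OF linear_fst] k(1)]) auto
  \<comment> \<open>The scalar \<open>s\<close> is \<open>-1\<close> for the shear and \<open>1\<close> for its inverse.\<close>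
  have "smooth_on (Y \<times> F) (\<lambda>p. snd p + s *\<^sub>R k (fst p))" for s
  proof -
    have "linear (\<lambda>p. fst p + s *\<^sub>R snd p :: 'b)"
      by (rule linearI) (simp_all add: algebra_simps)
    then have "smooth_on (Y \<times> F) ((\<lambda>p. fst p + s *\<^sub>R snd p) \<circ> (\<lambda>p. (snd p, (k \<circ> fst) p)))"
      by (intro smooth_on_compose[OF smooth_on_Pair[OF smooth_on_linear[OF linear_snd] kfst]
            smooth_on_linear]) auto
    then show ?thesis by (simp add: comp_def)
  qed
  then have "smooth_on (Y \<times> F) (\<lambda>p. (fst p, snd p + s *\<^sub>R k (fst p)))" for s
    by (rule smooth_on_Pair[OF smooth_on_linear[OF linear_fst]])
  from this[of "-1"] this[of 1]
  have r: "smooth_on (Y \<times> F) (\<lambda>(u, c). (u, c - k u))" "smooth_on (Y \<times> F) (\<lambda>(u, c). (u, c + k u))"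
    by (simp_all add: case_prod_unfold)
  have kF: "k u \<in> F" if "u \<in> Y" for u
    using k(2) that by blast
  show ?thesis
    unfolding partial_diffeo_def
  proof (intro conjI ballI)
    show "smooth_at (linear_manifold (E \<times> F)) (linear_manifold (E \<times> F)) (\<lambda>(u, c). (u, c - k u)) p"
      if "p \<in> Y \<times> F" for p
      by (rule smooth_at_linear_manifoldI[OF EF EF o r(1) _ that])
         (use YE kF subspace_diff[OF F] in auto)
    show "smooth_at (linear_manifold (E \<times> F)) (linear_manifold (E \<times> F)) (\<lambda>(u, c). (u, c + k u)) p"
      if "p \<in> Y \<times> F" for p
      by (rule smooth_at_linear_manifoldI[OF EF EF o r(2) _ that])
         (use YE kF subspace_add[OF F] in auto)
  qed (use o kF subspace_diff[OF F] subspace_add[OF F] in auto)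
qed

text \<open>Subtracting the coordinates of \<open>\<gamma>\<close> from the second component straightens the graph of \<open>\<gamma>\<close>.\<close>

lemma straighten_graph:
  assumes M: "smooth_atlas M" and N: "smooth_atlas N"
    and X: "openin (mtop M) X" "x0 \<in> X" and \<gamma>: "\<And>x. x \<in> X \<Longrightarrow> smooth_at M N \<gamma> x"
  obtains A C f g where
    "partial_diffeo (prod_manifold M N) A (linear_manifold (model M \<times> model N)) C f g" "(x0, \<gamma> x0) \<in> A"
    "\<And>x y. (x, y) \<in> A \<Longrightarrow> x \<in> X \<and> (snd (f (x, y)) = 0 \<longleftrightarrow> y = \<gamma> x)"
proof -
  have E: "subspace (model M)" "subspace (model N)"
    using M N by (auto simp: smooth_atlas_def)
  note MN = smooth_atlas_prod_manifold[OF M N]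
  obtain U \<phi> V \<psi> where c: "(U, \<phi>) \<in> smooth_charts M" "(V, \<psi>) \<in> smooth_charts N" "x0 \<in> U" "\<gamma> x0 \<in> V"
      "(U \<times> V, map_prod \<phi> \<psi>) \<in> smooth_charts (prod_manifold M N)"
    by (rule atlas_chart_prodE[OF M N smooth_at_in_points(1)[OF \<gamma>[OF X(2)]]
          smooth_at_in_points(2)[OF \<gamma>[OF X(2)]]])
  \<comment> \<open>The graph over \<open>X'\<close> stays inside the product chart; \<open>k\<close> is \<open>\<gamma>\<close> in coordinates.\<close>
  define X' where "X' = {x \<in> X \<inter> U. \<gamma> x \<in> V}"
  define k where "k = (\<lambda>u. \<psi> (\<gamma> (inv_into U \<phi> u)))"
  have X': "X' \<subseteq> X" "X' \<subseteq> U" "\<And>x. x \<in> X' \<Longrightarrow> \<gamma> x \<in> V" "x0 \<in> X'"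
    using c(3,4) X(2) by (auto simp: X'_def)
  have oX': "openin (mtop M) X'"
    unfolding X'_def using \<gamma> X(1) smooth_chartsD(1)[OF c(1)] smooth_chartsD(1)[OF c(2)]
    by (intro openin_preimage_smooth_at) auto
  have Y: "openin (top_of_set (model M)) (\<phi> ` X')"
    by (rule is_chart_image_openin[OF smooth_charts_is_chart[OF c(1)] oX' X'(2)])
  have kphi: "k (\<phi> x) = \<psi> (\<gamma> x)" if "x \<in> X'" for x
    using that X'(2) c(1) by (auto simp: k_def)
  have "smooth_on (\<phi> ` X') k"
  proof (rule smooth_at_linear_manifold_imp_smooth_on[OF E])
    fix u assume "u \<in> \<phi> ` X'"
    then obtain x where x: "x \<in> X'" "u = \<phi> x" by blast
    then have inv: "inv_into U \<phi> u = x" "u \<in> \<phi> ` U"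
      using X'(2) c(1) by auto
    note L = smooth_atlas_linear_manifold(1)[OF E(1)]
    have "x \<in> X" "\<gamma> x \<in> V"
      using x(1) X' by auto
    then have g: "smooth_at M N \<gamma> (inv_into U \<phi> u)" "\<gamma> (inv_into U \<phi> u) \<in> V"
      using \<gamma> inv(1) by auto
    have "smooth_at (linear_manifold (model M)) N (\<lambda>u. \<gamma> (inv_into U \<phi> u)) u"
      by (rule smooth_at_compose[OF L M smooth_at_inv_chart[OF M c(1) inv(2)] g(1)])
    then show "smooth_at (linear_manifold (model M)) (linear_manifold (model N)) k u"
      unfolding k_def
      by (rule smooth_at_compose[where f = "\<lambda>u. \<gamma> (inv_into U \<phi> u)", OF L N _
            smooth_at_chart[OF N c(2) g(2)]])
  qed
  moreover have "k ` \<phi> ` X' \<subseteq> model N"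
    using kphi X'(3) smooth_chartsD(4)[OF c(2)] by force
  ultimately have shear: "partial_diffeo (linear_manifold (model M \<times> model N)) (\<phi> ` X' \<times> model N)
      (linear_manifold (model M \<times> model N)) (\<phi> ` X' \<times> model N)
      (\<lambda>(u, c). (u, c - k u)) (\<lambda>(u, c). (u, c + k u))"
    by (rule shear_partial_diffeo[OF E Y])
  have chart: "partial_diffeo (prod_manifold M N) (U \<times> V) (linear_manifold (model M \<times> model N))
      (map_prod \<phi> \<psi> ` (U \<times> V)) (map_prod \<phi> \<psi>) (inv_into (U \<times> V) (map_prod \<phi> \<psi>))"
    using partial_diffeo_chart[OF MN c(5)] by simp
  note L = smooth_atlas_linear_manifold(1)[OF subspace_Times[OF E]]
  show ?thesis
  proof (rule that[OF partial_diffeo_compose[OF MN L L chart shear]])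
    show "(x0, \<gamma> x0) \<in> {x \<in> U \<times> V. map_prod \<phi> \<psi> x \<in> \<phi> ` X' \<times> model N}"
      using c(3,4) X'(4) smooth_chartsD(4)[OF c(2)] by auto
    fix x y assume "(x, y) \<in> {x \<in> U \<times> V. map_prod \<phi> \<psi> x \<in> \<phi> ` X' \<times> model N}"
    then have xy: "x \<in> U" "y \<in> V" "\<phi> x \<in> \<phi> ` X'" by auto
    then have x: "x \<in> X'"
      using X'(2) smooth_chartsD(3)[OF c(1)] by (auto dest: inj_onD)
    have "\<psi> y = \<psi> (\<gamma> x) \<longleftrightarrow> y = \<gamma> x"
      using xy(2) X'(3)[OF x] smooth_chartsD(3)[OF c(2)] by (auto dest: inj_onD)
    then show "x \<in> X \<and> (snd ((\<lambda>(u, c). (u, c - k u)) (map_prod \<phi> \<psi> (x, y))) = 0 \<longleftrightarrow> y = \<gamma> x)"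
      using x X'(1) kphi[OF x] by auto
  qed
qed

text \<open>The subspace of the slice charts has to be the same at every point. It is the image of
  \<open>model M \<times> {0}\<close> under one linear isomorphism \<open>model M \<times> model N \<rightarrow> model P\<close>, which exists
  because the diffeomorphisms \<open>\<theta>\<close> force the dimensions to agree.\<close>

lemma locally_graph_imp_embedded_submanifold:
  assumes P: "smooth_atlas P" and M: "smooth_atlas M" and N: "smooth_atlas N" and S: "S \<subseteq> points P"
    and graph: "\<And>p. p \<in> S \<Longrightarrow> \<exists>A C \<theta> \<theta>' X \<gamma>. partial_diffeo P A (prod_manifold M N) C \<theta> \<theta>' \<and> p \<in> A \<and>
      openin (mtop M) X \<and> (\<forall>x\<in>X. smooth_at M N \<gamma> x) \<and>
      (\<forall>q\<in>A. q \<in> S \<longleftrightarrow> fst (\<theta> q) \<in> X \<and> snd (\<theta> q) = \<gamma> (fst (\<theta> q)))"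
  shows "\<exists>W. embedded_submanifold P S W"
proof (cases "S = {}")
  case True
  have "subspace (model P)"
    using P by (simp add: smooth_atlas_def)
  then show ?thesis
    using True by (auto simp: embedded_submanifold_def)
next
  case False
  let ?E = "model M \<times> model N"
  note MN = smooth_atlas_prod_manifold[OF M N]
  have subsp: "subspace ?E" "subspace (model P)" "subspace (model M \<times> {0::'f})"
    using P M N by (auto simp: smooth_atlas_def intro!: subspace_Times)
  \<comment> \<open>Any one of the given diffeomorphisms yields the equality of dimensions.\<close>
  obtain p0 A0 C0 \<theta>0 \<theta>0' where p0: "partial_diffeo P A0 (prod_manifold M N) C0 \<theta>0 \<theta>0'" "p0 \<in> A0"
    using False graph by blast
  have "dim (model P) \<le> dim ?E" "dim ?E \<le> dim (model P)"
    using partial_diffeo_dim_le[OF P MN p0(1)] partial_diffeo_dim_le[OF MN P partial_diffeo_sym[OF p0(1)]]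
      p0(2) partial_diffeoD(3)[OF p0(1)] by auto
  then have "dim ?E = dim (model P)" by simp
  then obtain L K where L: "linear L" "partial_diffeo (linear_manifold ?E) ?E (linear_manifold (model P)) (model P) L K"
    using linear_partial_diffeo_exists[OF subsp(1,2)] by metis
  note LD = partial_diffeoD[OF L(2)]
  define W where "W = L ` (model M \<times> {0})"
  have W: "subspace W" "W \<subseteq> model P"
    using linear_subspace_image[OF L(1) subsp(3)] LD(3) N
    by (auto simp: W_def smooth_atlas_def subspace_0)
  have L_W: "L z \<in> W \<longleftrightarrow> snd z = 0" if "z \<in> ?E" for z
  proof
    assume "L z \<in> W"
    then obtain w where w: "w \<in> model M \<times> {0}" "L z = L w" by (auto simp: W_def)
    moreover have "w \<in> ?E"
      using w(1) N by (auto simp: smooth_atlas_def subspace_0)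
    ultimately have "z = w"
      using LD(5) that by metis
    then show "snd z = 0" using w(1) by auto
  qed (use that in \<open>auto simp: W_def\<close>)
  have "\<exists>(U, \<phi>)\<in>slice_charts P S W. p \<in> U" if p: "p \<in> S" for p
  proof -
    obtain A C \<theta> \<theta>' X \<gamma> where g: "partial_diffeo P A (prod_manifold M N) C \<theta> \<theta>'" "p \<in> A"
        "openin (mtop M) X" "\<forall>x\<in>X. smooth_at M N \<gamma> x"
        "\<forall>q\<in>A. q \<in> S \<longleftrightarrow> fst (\<theta> q) \<in> X \<and> snd (\<theta> q) = \<gamma> (fst (\<theta> q))"
      using graph[OF p] by blast
    have x0: "fst (\<theta> p) \<in> X" "\<theta> p = (fst (\<theta> p), \<gamma> (fst (\<theta> p)))"
      using g(2,5) p by (auto simp: prod_eq_iff)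
    obtain A' C' f f' where f: "partial_diffeo (prod_manifold M N) A' (linear_manifold ?E) C' f f'"
        "(fst (\<theta> p), \<gamma> (fst (\<theta> p))) \<in> A'"
        "\<And>x y. (x, y) \<in> A' \<Longrightarrow> x \<in> X \<and> (snd (f (x, y)) = 0 \<longleftrightarrow> y = \<gamma> x)"
      using straighten_graph[OF M N g(3) x0(1) bspec[OF g(4)]] by metis
    note LM = smooth_atlas_linear_manifold(1)[OF subsp(1)] smooth_atlas_linear_manifold(1)[OF subsp(2)]
    have \<theta>f: "partial_diffeo P {q\<in>A. \<theta> q \<in> A'} (linear_manifold ?E) {z\<in>C'. f' z \<in> C}
        (\<lambda>q. f (\<theta> q)) (\<lambda>z. \<theta>' (f' z))"
      by (rule partial_diffeo_compose[OF P MN LM(1) g(1) f(1)])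
    define U where "U = {q \<in> {q\<in>A. \<theta> q \<in> A'}. f (\<theta> q) \<in> ?E}"
    have chart: "(U, \<lambda>q. L (f (\<theta> q))) \<in> smooth_charts P"
      unfolding U_def
      by (rule partial_diffeo_imp_chart[OF P partial_diffeo_compose[OF P LM \<theta>f L(2)]])
    have "q \<in> S \<longleftrightarrow> L (f (\<theta> q)) \<in> W" if "q \<in> U" for q
    proof -
      have q: "q \<in> A" "(fst (\<theta> q), snd (\<theta> q)) \<in> A'" "f (\<theta> q) \<in> ?E"
        using that by (auto simp: U_def)
      have "L (f (\<theta> q)) \<in> W \<longleftrightarrow> snd (\<theta> q) = \<gamma> (fst (\<theta> q))"
        using L_W[OF q(3)] f(3)[OF q(2)] by simp
      then show ?thesis
        using g(5) q(1) f(3)[OF q(2)] by blast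
    qed
    then have "(\<lambda>q. L (f (\<theta> q))) ` (U \<inter> S) = (\<lambda>q. L (f (\<theta> q))) ` U \<inter> W" by auto
    moreover have "p \<in> U"
      using g(2) f(2) x0(2) smooth_at_in_points(2)[OF partial_diffeoD(7)[OF f(1) f(2)]]
      by (simp add: U_def flip: x0(2))
    ultimately show ?thesis
      using chart by (auto simp: slice_charts_def)
  qed
  then show ?thesis
    using S W by (auto simp: embedded_submanifold_def)
qed

section \<open>The principal bundle\<close>

lemma smooth_at_prod_open_submanifold_inclusion:
  assumes M: "smooth_atlas M" and N: "smooth_atlas N" and T: "openin (mtop M) T"
    and y: "y \<in> T \<times> points N"
  shows "smooth_at (prod_manifold (open_submanifold M T) N) (prod_manifold M N) (\<lambda>y. y) y"
    and "smooth_at (prod_manifold M N) (prod_manifold (open_submanifold M T) N) (\<lambda>y. y) y"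
proof -
  note O = smooth_atlas_open_submanifold[OF M T]
  note ON = smooth_atlas_prod_manifold[OF O N] and MN = smooth_atlas_prod_manifold[OF M N]
  have y1: "y \<in> points (prod_manifold (open_submanifold M T) N)" "y \<in> points (prod_manifold M N)" "fst y \<in> T"
    using y points_open_submanifold[OF T] openin_subset[OF T] by auto
  have "smooth_at (prod_manifold (open_submanifold M T) N) M fst y"
    using smooth_at_fst[OF O N y1(1)] smooth_at_into_open_submanifold[OF ON M T] by blast
  then show "smooth_at (prod_manifold (open_submanifold M T) N) (prod_manifold M N) (\<lambda>y. y) y"
    using smooth_at_Pair[OF ON M N _ smooth_at_snd[OF O N y1(1)], of fst] by simp
  have "smooth_at (prod_manifold M N) (open_submanifold M T) fst y"
    using smooth_at_fst[OF M N y1(2)] smooth_at_into_open_submanifold[OF MN M T] y1(3) by blast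
  then show "smooth_at (prod_manifold M N) (prod_manifold (open_submanifold M T) N) (\<lambda>y. y) y"
    using smooth_at_Pair[OF MN O N _ smooth_at_snd[OF M N y1(2)], of fst] by simp
qed

lemma diffeomorphism_open_submanifolds_imp_smooth_at:
  assumes M: "smooth_atlas M" and N: "smooth_atlas N" and A: "openin (mtop M) A"
    and f: "diffeomorphism (open_submanifold M A) N f"
  shows "\<And>x. x \<in> A \<Longrightarrow> smooth_at M N f x" "\<And>y. y \<in> points N \<Longrightarrow> smooth_at N M (inv_into A f) y"
    "bij_betw f A (points N)"
proof -
  have "smooth_map N (open_submanifold M A) (inv_into A f)"
    using f points_open_submanifold[OF A] by (simp add: diffeomorphism_def)
  then show "smooth_at N M (inv_into A f) y" if "y \<in> points N" for y
    using smooth_map_imp_smooth_at[OF N smooth_atlas_open_submanifold[OF M A] _ that]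
      smooth_at_into_open_submanifold[OF N M A] by blast
  show "smooth_at M N f x" if "x \<in> A" for x
    using f smooth_map_open_submanifold_iff[OF M N A] that by (auto simp: diffeomorphism_def)
  show "bij_betw f A (points N)"
    using f points_open_submanifold[OF A] by (simp add: diffeomorphism_def)
qed

lemma principal_bundle_smooth_atlas:
  assumes "principal_bundle G MG Q l B"
  shows "smooth_atlas MG" "smooth_atlas Q" "smooth_atlas B"
  using assms by (auto simp: principal_bundle_def lie_group_def intro: smooth_manifold_imp_smooth_atlas)

lemma principal_bundle_smooth_at_orbit:
  assumes "principal_bundle G MG Q l B" "q \<in> points Q"
  shows "smooth_at Q B (orbit G l) q"
  using smooth_map_imp_smooth_at[OF principal_bundle_smooth_atlas(2,3)[OF assms(1)] _ assms(2)] assms(1)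
  by (simp add: principal_bundle_def)

text \<open>The trivialization in the form in which it is used: with values in \<open>B \<times> G\<close> rather than in the
  product of an open submanifold, and with the first component spelled out, so that it consists of
  the projection and a fibre coordinate \<open>s\<close>.\<close>

lemma principal_bundle_trivialization:
  assumes pb: "principal_bundle G MG Q l B" and r: "r \<in> points B"
  obtains V s \<Psi> where "openin (mtop B) V" "r \<in> V"
    "partial_diffeo Q {q \<in> points Q. orbit G l q \<in> V} (prod_manifold B MG) (V \<times> points MG)
       (\<lambda>q. (orbit G l q, s q)) \<Psi>"
proof -
  note MG = principal_bundle_smooth_atlas(1)[OF pb] and Q = principal_bundle_smooth_atlas(2)[OF pb]
    and B = principal_bundle_smooth_atlas(3)[OF pb]
  obtain V \<Phi> where V: "openin (mtop B) V" "r \<in> V"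
    and \<Phi>: "diffeomorphism (open_submanifold Q {q \<in> points Q. orbit G l q \<in> V})
        (prod_manifold (open_submanifold B V) MG) \<Phi>"
      "\<forall>q\<in>points Q. orbit G l q \<in> V \<longrightarrow> fst (\<Phi> q) = orbit G l q \<and>
        (\<forall>g\<in>carrier G. \<Phi> (l g q) = (orbit G l q, g \<otimes>\<^bsub>G\<^esub> snd (\<Phi> q)))"
    using pb[unfolded principal_bundle_def] r
    by (elim conjE) (drule (1) bspec, elim exE conjE, rule that)
  let ?A = "{q \<in> points Q. orbit G l q \<in> V}" and ?C = "V \<times> points MG"
  let ?N = "prod_manifold (open_submanifold B V) MG"
  have A: "openin (mtop Q) ?A"
    by (rule openin_preimage_smooth_at[OF principal_bundle_smooth_at_orbit[OF pb] openin_topspace V(1)])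
  note N = smooth_atlas_prod_manifold[OF smooth_atlas_open_submanifold[OF B V(1)] MG]
  note BG = smooth_atlas_prod_manifold[OF B MG]
  note incl = smooth_at_prod_open_submanifold_inclusion[OF B MG V(1)]
  have pN: "points ?N = ?C"
    by (simp add: points_open_submanifold[OF V(1)])
  note D = diffeomorphism_open_submanifolds_imp_smooth_at[OF Q N A \<Phi>(1), unfolded pN]
  have \<Phi>_eq: "(orbit G l q, snd (\<Phi> q)) = \<Phi> q" if "q \<in> ?A" for q
    using \<Phi>(2) that by (auto simp: prod_eq_iff)
  have \<Phi>C: "\<Phi> q \<in> ?C" if "q \<in> ?A" for q
    using D(3) that bij_betwE by blast
  have inv: "inv_into ?A \<Phi> y \<in> ?A" "\<Phi> (inv_into ?A \<Phi> y) = y" if "y \<in> ?C" for y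
    using that bij_betw_imp_surj_on[OF D(3)] inv_into_into[of y \<Phi> ?A] f_inv_into_f[of y \<Phi> ?A]
    by (simp_all only:)
  have "partial_diffeo Q ?A (prod_manifold B MG) ?C (\<lambda>q. (orbit G l q, snd (\<Phi> q))) (inv_into ?A \<Phi>)"
    unfolding partial_diffeo_def
  proof (intro conjI ballI A)
    show "openin (mtop (prod_manifold B MG)) ?C"
      using V(1) by (simp add: prod_manifold_def openin_prod_Times_iff)
    show "(\<lambda>q. (orbit G l q, snd (\<Phi> q))) ` ?A \<subseteq> ?C"
      by (rule image_subsetI) (simp only: \<Phi>_eq \<Phi>C)
    show "inv_into ?A \<Phi> ` ?C \<subseteq> ?A"
      using inv(1) by blast
    show "inv_into ?A \<Phi> (orbit G l q, snd (\<Phi> q)) = q" if "q \<in> ?A" for q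
      unfolding \<Phi>_eq[OF that] by (rule bij_betw_inv_into_left[OF D(3) that])
    show "(orbit G l (inv_into ?A \<Phi> y), snd (\<Phi> (inv_into ?A \<Phi> y))) = y" if "y \<in> ?C" for y
      using \<Phi>_eq[OF inv(1)[OF that]] inv(2)[OF that] by simp
    show "smooth_at Q (prod_manifold B MG) (\<lambda>q. (orbit G l q, snd (\<Phi> q))) q" if "q \<in> ?A" for q
      by (rule smooth_at_cong[OF smooth_at_compose[OF Q N D(1)[OF that] incl(1)[OF \<Phi>C[OF that]]] A that])
         (simp add: \<Phi>_eq)
    show "smooth_at (prod_manifold B MG) Q (inv_into ?A \<Phi>) y" if "y \<in> ?C" for y
      by (rule smooth_at_compose[OF BG N incl(2)[OF that] D(2)[OF that]])
  qed
  then show ?thesis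
    by (rule that[OF V])
qed

lemma (in group_action) orbit_translate:
  assumes "x \<in> E" "g \<in> carrier G"
  shows "orbit G \<phi> (\<phi> g x) = orbit G \<phi> x"
proof -
  interpret group G
    using group_hom group_hom.axioms(1) by auto
  have "\<phi> h (\<phi> g x) \<in> orbit G \<phi> x" if "h \<in> carrier G" for h
    using composition_rule[OF assms(1) that assms(2)] that assms(2) unfolding orbit_def
    by (metis (mono_tags, lifting) m_closed mem_Collect_eq)
  moreover have "\<phi> h x \<in> orbit G \<phi> (\<phi> g x)" if "h \<in> carrier G" for h
  proof -
    have "\<phi> h x = \<phi> (h \<otimes> inv g) (\<phi> g x)"
      using composition_rule[OF assms(1), of "h \<otimes> inv g" g] that assms(2) by (simp add: m_assoc)
    then show ?thesis
      using that assms(2) unfolding orbit_def by (metis (mono_tags, lifting) inv_closed m_closed mem_Collect_eq)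
  qed
  ultimately show ?thesis
    by (auto simp: orbit_def)
qed

lemma id_times_pi_Pair [simp]: "id_times_pi G l (a, b) = (a, orbit G l b)"
  by (simp add: id_times_pi_def)

lemma smooth_at_id_times_pi:
  assumes pb: "principal_bundle G MG Q l B" and x: "x \<in> points Q \<times> points Q"
  shows "smooth_at (prod_manifold Q Q) (prod_manifold Q B) (id_times_pi G l) x"
proof -
  note Q = principal_bundle_smooth_atlas(2)[OF pb] and B = principal_bundle_smooth_atlas(3)[OF pb]
  note QQ = smooth_atlas_prod_manifold[OF Q Q]
  have x': "x \<in> points (prod_manifold Q Q)" "snd x \<in> points Q"
    using x by auto
  have "smooth_at (prod_manifold Q Q) (prod_manifold Q B) (\<lambda>x. (fst x, orbit G l (snd x))) x"
    by (rule smooth_at_Pair[OF QQ Q B smooth_at_fst[OF Q Q x'(1)] smooth_at_compose[OF QQ Q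
            smooth_at_snd[OF Q Q x'(1)] principal_bundle_smooth_at_orbit[OF pb x'(2)]]])
  moreover have "id_times_pi G l = (\<lambda>x. (fst x, orbit G l (snd x)))"
    by (auto simp: id_times_pi_def)
  ultimately show ?thesis by simp
qed


section \<open>The horizontal lift of a discrete connection\<close>

lemma horizontal_lift_id_times_pi:
  "inj_on (id_times_pi G l) Hor \<Longrightarrow> p \<in> Hor \<Longrightarrow> horizontal_lift G l Hor (id_times_pi G l p) = p"
  by (simp add: horizontal_lift_def the_inv_into_f_f)

text \<open>On a set \<open>U\<close> from the definition of a local diffeomorphism, the inverse of \<open>id \<times> \<pi>\<close> is smooth
  into the submanifold, hence into \<open>Q \<times> Q\<close>. By injectivity on all of \<open>Hor\<close> it is the lift.\<close>

lemma discrete_connection_local_sections: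
  assumes pb: "principal_bundle G MG Q l B" and dc: "discrete_connection G Q l B Hor" and p: "p \<in> Hor"
  obtains U where "p \<in> U" "U \<subseteq> Hor" "openin (mtop (prod_manifold Q B)) (id_times_pi G l ` U)"
    "smooth_at (prod_manifold Q B) (prod_manifold Q Q) (horizontal_lift G l Hor) (id_times_pi G l p)"
proof -
  note Q = principal_bundle_smooth_atlas(2)[OF pb] and B = principal_bundle_smooth_atlas(3)[OF pb]
  note QQ = smooth_atlas_prod_manifold[OF Q Q] and QB = smooth_atlas_prod_manifold[OF Q B]
  let ?f = "id_times_pi G l" and ?QQ = "prod_manifold Q Q" and ?QB = "prod_manifold Q B"
  obtain W where W: "embedded_submanifold ?QQ Hor W"
    "local_diffeomorphism (submanifold ?QQ Hor W) ?QB ?f" and inj: "inj_on ?f Hor"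
    using dc by (auto simp: discrete_connection_def)
  let ?H = "submanifold ?QQ Hor W"
  note H = smooth_atlas_submanifold[OF QQ W(1)]
  obtain U where U: "openin (mtop ?H) U" "p \<in> U" "openin (mtop ?QB) (?f ` U)"
      "diffeomorphism (open_submanifold ?H U) (open_submanifold ?QB (?f ` U)) ?f"
    using W(2) p points_submanifold[OF W(1)] unfolding local_diffeomorphism_def by blast
  have UH: "U \<subseteq> Hor"
    using openin_subset[OF U(1)] points_submanifold[OF W(1)] by simp
  note O = smooth_atlas_open_submanifold[OF QB U(3)]
  have x: "?f p \<in> ?f ` U"
    using U(2) by blast
  then have "smooth_at (open_submanifold ?QB (?f ` U)) ?H (inv_into U ?f) (?f p)"
    using diffeomorphism_open_submanifolds_imp_smooth_at(2)[OF H O U(1,4)]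
      points_open_submanifold[OF U(3)] by blast
  then have "smooth_at ?QB ?H (inv_into U ?f) (?f p)"
    using smooth_at_open_submanifold[OF QB U(3) x] by blast
  moreover have inv: "inv_into U ?f (?f u) = u" if "u \<in> U" for u
    using that inj_on_subset[OF inj UH] by simp
  then have "smooth_at ?H ?QQ (\<lambda>y. y) (inv_into U ?f (?f p))"
    using smooth_at_submanifold_inclusion[OF QQ W(1) p] U(2) by simp
  ultimately have "smooth_at ?QB ?QQ (inv_into U ?f) (?f p)"
    by (rule smooth_at_compose[OF QB H])
  then have "smooth_at ?QB ?QQ (horizontal_lift G l Hor) (?f p)"
  proof (rule smooth_at_cong[OF _ U(3) x])
    fix y assume "y \<in> ?f ` U"
    then obtain u where u: "u \<in> U" "y = ?f u" by blast
    then show "inv_into U ?f y = horizontal_lift G l Hor y"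
      using inv[OF u(1)] horizontal_lift_id_times_pi[OF inj subsetD[OF UH u(1)]] by simp
  qed
  then show ?thesis
    by (rule that[OF U(2) UH U(3)])
qed

lemma horizontal_lift_properties:
  assumes pb: "principal_bundle G MG Q l B" and dc: "discrete_connection G Q l B Hor"
  shows "openin (mtop (prod_manifold Q B)) (lift_domain G l Hor)"
    and "invariant_set G (act_QB l) (lift_domain G l Hor)"
    and "smooth_map (open_submanifold (prod_manifold Q B) (lift_domain G l Hor))
          (prod_manifold Q Q) (horizontal_lift G l Hor)"
    and "equivariant_on G (lift_domain G l Hor) (act_QB l) (act_QQ l) (horizontal_lift G l Hor)"
    and "\<forall>x\<in>lift_domain G l Hor. id_times_pi G l (horizontal_lift G l Hor x) = x"
    and "\<forall>q0\<in>points Q. (q0, orbit G l q0) \<in> lift_domain G l Hor \<and>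
           horizontal_lift G l Hor (q0, orbit G l q0) = (q0, q0)"
proof -
  note Q = principal_bundle_smooth_atlas(2)[OF pb] and B = principal_bundle_smooth_atlas(3)[OF pb]
  note QQ = smooth_atlas_prod_manifold[OF Q Q] and QB = smooth_atlas_prod_manifold[OF Q B]
  interpret group_action G "points Q" l
    using pb by (simp add: principal_bundle_def smooth_action_def)
  have inj: "inj_on (id_times_pi G l) Hor" and inv: "invariant_set G (act_QQ l) Hor"
    and diag: "Id_on (points Q) \<subseteq> Hor" and sub: "Hor \<subseteq> points Q \<times> points Q"
    using dc by (auto simp: discrete_connection_def embedded_submanifold_def)
  note lift = horizontal_lift_id_times_pi[OF inj]
  have equiv: "id_times_pi G l (act_QQ l g p) = act_QB l g (id_times_pi G l p)"
    if "g \<in> carrier G" "p \<in> Hor" for g p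
    using that sub orbit_translate by (auto simp: id_times_pi_def act_QQ_def act_QB_def)
  show op: "openin (mtop (prod_manifold Q B)) (lift_domain G l Hor)"
  proof (subst openin_subopen, intro ballI)
    fix x assume "x \<in> lift_domain G l Hor"
    then obtain p where p: "p \<in> Hor" "x = id_times_pi G l p"
      unfolding lift_domain_def by blast
    obtain U where "p \<in> U" "U \<subseteq> Hor" "openin (mtop (prod_manifold Q B)) (id_times_pi G l ` U)"
      using discrete_connection_local_sections[OF pb dc p(1)] by metis
    then show "\<exists>T. openin (mtop (prod_manifold Q B)) T \<and> x \<in> T \<and> T \<subseteq> lift_domain G l Hor"
      using p(2) by (intro exI[of _ "id_times_pi G l ` U"]) (auto simp: lift_domain_def)
  qed
  show "invariant_set G (act_QB l) (lift_domain G l Hor)"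
    unfolding invariant_set_def
  proof (intro ballI)
    fix g x assume g: "g \<in> carrier G" and "x \<in> lift_domain G l Hor"
    then obtain p where p: "p \<in> Hor" "x = id_times_pi G l p"
      unfolding lift_domain_def by blast
    have "act_QQ l g p \<in> Hor"
      using inv g p(1) by (simp add: invariant_set_def)
    then show "act_QB l g x \<in> lift_domain G l Hor"
      unfolding lift_domain_def p(2) equiv[OF g p(1), symmetric] by (rule imageI)
  qed
  have "smooth_at (prod_manifold Q B) (prod_manifold Q Q) (horizontal_lift G l Hor) x"
    if x: "x \<in> lift_domain G l Hor" for x
  proof -
    obtain p where p: "p \<in> Hor" "x = id_times_pi G l p"
      using x unfolding lift_domain_def by blast
    then show ?thesis
      using discrete_connection_local_sections[OF pb dc p(1)] by metis
  qed
  then show "smooth_map (open_submanifold (prod_manifold Q B) (lift_domain G l Hor))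
      (prod_manifold Q Q) (horizontal_lift G l Hor)"
    using smooth_map_open_submanifold_iff[OF QB QQ op] by blast
  show "equivariant_on G (lift_domain G l Hor) (act_QB l) (act_QQ l) (horizontal_lift G l Hor)"
    unfolding equivariant_on_def
  proof (intro ballI)
    fix g x assume g: "g \<in> carrier G" and "x \<in> lift_domain G l Hor"
    then obtain p where p: "p \<in> Hor" "x = id_times_pi G l p"
      unfolding lift_domain_def by blast
    have "act_QQ l g p \<in> Hor"
      using inv g p(1) by (simp add: invariant_set_def)
    then show "horizontal_lift G l Hor (act_QB l g x) = act_QQ l g (horizontal_lift G l Hor x)"
      unfolding p(2) equiv[OF g p(1), symmetric] by (simp only: lift p(1))
  qed
  show "\<forall>x\<in>lift_domain G l Hor. id_times_pi G l (horizontal_lift G l Hor x) = x"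
    using lift by (auto simp: lift_domain_def)
  show "\<forall>q0\<in>points Q. (q0, orbit G l q0) \<in> lift_domain G l Hor \<and>
      horizontal_lift G l Hor (q0, orbit G l q0) = (q0, q0)"
  proof
    fix q assume "q \<in> points Q"
    then have "(q, q) \<in> Hor"
      using diag by auto
    then show "(q, orbit G l q) \<in> lift_domain G l Hor \<and> horizontal_lift G l Hor (q, orbit G l q) = (q, q)"
      using lift[of "(q, q)"] imageI[of "(q, q)" Hor "id_times_pi G l"] by (simp add: lift_domain_def)
  qed
qed


section \<open>The discrete connection of an equivariant section\<close>

text \<open>In these coordinates \<open>id \<times> \<pi>\<close> is the first projection.\<close>

lemma trivialization_prod:
  assumes pb: "principal_bundle G MG Q l B" and V: "openin (mtop B) V"
    and s: "partial_diffeo Q {q \<in> points Q. orbit G l q \<in> V} (prod_manifold B MG) (V \<times> points MG)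
      (\<lambda>q. (orbit G l q, s q)) \<Psi>"
  shows "partial_diffeo (prod_manifold Q Q) (points Q \<times> {q \<in> points Q. orbit G l q \<in> V})
    (prod_manifold (prod_manifold Q B) MG) ((points Q \<times> V) \<times> points MG)
    (\<lambda>x. (id_times_pi G l x, s (snd x))) (\<lambda>z. (fst (fst z), \<Psi> (snd (fst z), snd z)))"
proof -
  note MG = principal_bundle_smooth_atlas(1)[OF pb] and Q = principal_bundle_smooth_atlas(2)[OF pb]
    and B = principal_bundle_smooth_atlas(3)[OF pb]
  note QQ = smooth_atlas_prod_manifold[OF Q Q] and QB = smooth_atlas_prod_manifold[OF Q B]
    and BG = smooth_atlas_prod_manifold[OF B MG]
  note QBG = smooth_atlas_prod_manifold[OF QB MG]
  note sD = partial_diffeoD[OF s]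
  let ?A = "{q \<in> points Q. orbit G l q \<in> V}"
  show ?thesis
    unfolding partial_diffeo_def
  proof (intro conjI ballI)
    show "openin (mtop (prod_manifold Q Q)) (points Q \<times> ?A)"
      using sD(1) by (simp add: prod_manifold_def openin_prod_Times_iff)
    show "openin (mtop (prod_manifold (prod_manifold Q B) MG)) ((points Q \<times> V) \<times> points MG)"
      using V by (simp add: prod_manifold_def openin_prod_Times_iff)
    show "(\<lambda>x. (id_times_pi G l x, s (snd x))) ` (points Q \<times> ?A) \<subseteq> (points Q \<times> V) \<times> points MG"
      using sD(3) by fastforce
    show "(\<lambda>z. (fst (fst z), \<Psi> (snd (fst z), snd z))) ` ((points Q \<times> V) \<times> points MG) \<subseteq> points Q \<times> ?A"
      using sD(4) by fastforce
    show "smooth_at (prod_manifold Q Q) (prod_manifold (prod_manifold Q B) MG)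
        (\<lambda>x. (id_times_pi G l x, s (snd x))) x" if x: "x \<in> points Q \<times> ?A" for x
    proof -
      have x': "x \<in> points (prod_manifold Q Q)" "x \<in> points Q \<times> points Q" "snd x \<in> ?A"
        using x by auto
      have sx: "(orbit G l (snd x), s (snd x)) \<in> points (prod_manifold B MG)"
        by (rule smooth_at_in_points(2)[OF sD(7)[OF x'(3)]])
      have "smooth_at Q MG s (snd x)"
        using smooth_at_compose[OF Q BG sD(7)[OF x'(3)] smooth_at_snd[OF B MG sx]] by simp
      then show ?thesis
        by (rule smooth_at_Pair[OF QQ QB MG smooth_at_id_times_pi[OF pb x'(2)]
              smooth_at_compose[OF QQ Q smooth_at_snd[OF Q Q x'(1)]]])
    qed
    show "smooth_at (prod_manifold (prod_manifold Q B) MG) (prod_manifold Q Q)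
        (\<lambda>z. (fst (fst z), \<Psi> (snd (fst z), snd z))) z" if z: "z \<in> (points Q \<times> V) \<times> points MG" for z
    proof -
      have z': "z \<in> points (prod_manifold (prod_manifold Q B) MG)" "fst z \<in> points (prod_manifold Q B)"
        "(snd (fst z), snd z) \<in> V \<times> points MG"
        using z openin_subset[OF V] by auto
      note f1 = smooth_at_fst[OF QB MG z'(1)] and f2 = smooth_at_snd[OF QB MG z'(1)]
      have "smooth_at (prod_manifold (prod_manifold Q B) MG) (prod_manifold B MG) (\<lambda>z. (snd (fst z), snd z)) z"
        by (rule smooth_at_Pair[OF QBG B MG smooth_at_compose[OF QBG QB f1 smooth_at_snd[OF Q B z'(2)]] f2])
      then have "smooth_at (prod_manifold (prod_manifold Q B) MG) Q (\<lambda>z. \<Psi> (snd (fst z), snd z)) z"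
        by (rule smooth_at_compose[where f = "\<lambda>z. (snd (fst z), snd z)", OF QBG BG _ sD(8)[OF z'(3)]])
      then show ?thesis
        by (rule smooth_at_Pair[OF QBG Q Q smooth_at_compose[OF QBG QB f1 smooth_at_fst[OF Q B z'(2)]]])
    qed
    show "(fst (fst (id_times_pi G l x, s (snd x))),
        \<Psi> (snd (fst (id_times_pi G l x, s (snd x))), snd (id_times_pi G l x, s (snd x)))) = x"
      if "x \<in> points Q \<times> ?A" for x
      using that sD(5) by auto
    show "(id_times_pi G l (fst (fst z), \<Psi> (snd (fst z), snd z)),
        s (snd (fst (fst z), \<Psi> (snd (fst z), snd z)))) = z" if "z \<in> (points Q \<times> V) \<times> points MG" for z
      using that sD(6)[of "(snd (fst z), snd z)"] by (auto simp: prod_eq_iff)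
  qed
qed

text \<open>In the coordinates of \<open>trivialization_prod\<close>, the image of \<open>h\<close> is the graph of the fibre
  coordinate of \<open>snd \<circ> h\<close>: a point \<open>q\<close> and \<open>h (id_times_pi G l q)\<close> lie over the same point of
  \<open>Q \<times> Q/G\<close>, so they agree as soon as their fibre coordinates do.\<close>

lemma section_image_embedded_submanifold:
  assumes pb: "principal_bundle G MG Q l B" and U': "openin (mtop (prod_manifold Q B)) U'"
    and h: "\<And>x. x \<in> U' \<Longrightarrow> smooth_at (prod_manifold Q B) (prod_manifold Q Q) h x"
    and sec: "\<And>x. x \<in> U' \<Longrightarrow> id_times_pi G l (h x) = x"
  shows "\<exists>W. embedded_submanifold (prod_manifold Q Q) (h ` U') W"
proof -
  note MG = principal_bundle_smooth_atlas(1)[OF pb] and Q = principal_bundle_smooth_atlas(2)[OF pb]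
    and B = principal_bundle_smooth_atlas(3)[OF pb]
  note QQ = smooth_atlas_prod_manifold[OF Q Q] and QB = smooth_atlas_prod_manifold[OF Q B]
    and BG = smooth_atlas_prod_manifold[OF B MG]
  have hp: "h x \<in> points Q \<times> points Q" if "x \<in> U'" for x
    using smooth_at_in_points(2)[OF h[OF that]] by simp
  have orb: "orbit G l (snd (h x)) = snd x" "fst (h x) = fst x" if "x \<in> U'" for x
    using arg_cong[OF sec[OF that], of snd] arg_cong[OF sec[OF that], of fst]
    by (simp_all add: id_times_pi_def)
  show ?thesis
  proof (rule locally_graph_imp_embedded_submanifold[OF QQ QB MG])
    show "h ` U' \<subseteq> points (prod_manifold Q Q)"
      unfolding points_prod_manifold by (rule image_subsetI) (rule hp)
    fix p assume "p \<in> h ` U'"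
    then obtain x0 where x0: "x0 \<in> U'" "p = h x0" by blast
    have rB: "snd x0 \<in> points B"
      using openin_subset[OF U'] x0(1) by auto
    obtain V s \<Psi> where V: "openin (mtop B) V" "snd x0 \<in> V"
      and s: "partial_diffeo Q {q \<in> points Q. orbit G l q \<in> V} (prod_manifold B MG) (V \<times> points MG)
        (\<lambda>q. (orbit G l q, s q)) \<Psi>"
      by (rule principal_bundle_trivialization[OF pb rB])
    note sD = partial_diffeoD[OF s]
    let ?A = "{q \<in> points Q. orbit G l q \<in> V}"
    let ?\<gamma> = "\<lambda>x. s (snd (h x))" and ?\<theta> = "\<lambda>x. (id_times_pi G l x, s (snd x))"
    define X where "X = U' \<inter> points Q \<times> V"
    have X: "openin (mtop (prod_manifold Q B)) X"
      unfolding X_def using V(1) by (intro openin_Int U') (simp add: prod_manifold_def openin_prod_Times_iff)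
    have sm: "smooth_at (prod_manifold Q B) MG ?\<gamma> x" if x: "x \<in> X" for x
    proof -
      have x': "x \<in> U'" "snd (h x) \<in> ?A" "h x \<in> points (prod_manifold Q Q)"
        using x hp[of x] orb[of x] by (auto simp: X_def)
      have sx: "(orbit G l (snd (h x)), s (snd (h x))) \<in> points (prod_manifold B MG)"
        by (rule smooth_at_in_points(2)[OF sD(7)[OF x'(2)]])
      have "smooth_at Q MG s (snd (h x))"
        using smooth_at_compose[OF Q BG sD(7)[OF x'(2)] smooth_at_snd[OF B MG sx]] by simp
      then show ?thesis
        by (rule smooth_at_compose[OF QB Q smooth_at_compose[OF QB QQ h[OF x'(1)] smooth_at_snd[OF Q Q x'(3)]]])
    qed
    have gr: "q \<in> h ` U' \<longleftrightarrow> fst (?\<theta> q) \<in> X \<and> snd (?\<theta> q) = ?\<gamma> (fst (?\<theta> q))"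
      if q: "q \<in> points Q \<times> ?A" for q
    proof
      assume "q \<in> h ` U'"
      then obtain x where "x \<in> U'" "q = h x" by blast
      then show "fst (?\<theta> q) \<in> X \<and> snd (?\<theta> q) = ?\<gamma> (fst (?\<theta> q))"
        using sec[of x] orb[of x] q by (auto simp: X_def mem_Times_iff)
    next
      assume *: "fst (?\<theta> q) \<in> X \<and> snd (?\<theta> q) = ?\<gamma> (fst (?\<theta> q))"
      let ?x = "id_times_pi G l q"
      have x: "?x \<in> U'" "s (snd q) = s (snd (h ?x))"
        using * by (auto simp: X_def)
      have "orbit G l (snd (h ?x)) = orbit G l (snd q)" "fst (h ?x) = fst q"
        using orb[OF x(1)] by (auto simp: id_times_pi_def)
      moreover have "snd q \<in> ?A" "snd (h ?x) \<in> ?A"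
        using q hp[OF x(1)] calculation(1) by auto
      \<comment> \<open>\<open>snd q\<close> and \<open>snd (h ?x)\<close> have the same image under the trivialization.\<close>
      ultimately have "snd q = snd (h ?x)" "fst q = fst (h ?x)"
        using sD(5)[of "snd q"] sD(5)[of "snd (h ?x)"] x(2) by auto
      then have "q = h ?x"
        by (simp add: prod_eq_iff)
      then show "q \<in> h ` U'"
        using x(1) by blast
    qed
    have pA: "p \<in> points Q \<times> ?A"
      using hp[OF x0(1)] orb(1)[OF x0(1)] x0(2) V(2) by (auto simp: mem_Times_iff)
    show "\<exists>A C \<theta> \<theta>' X \<gamma>. partial_diffeo (prod_manifold Q Q) A (prod_manifold (prod_manifold Q B) MG) C \<theta> \<theta>' \<and>
        p \<in> A \<and> openin (mtop (prod_manifold Q B)) X \<and> (\<forall>x\<in>X. smooth_at (prod_manifold Q B) MG \<gamma> x) \<and>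
        (\<forall>q\<in>A. q \<in> h ` U' \<longleftrightarrow> fst (\<theta> q) \<in> X \<and> snd (\<theta> q) = \<gamma> (fst (\<theta> q)))"
    proof (rule exI[of _ "points Q \<times> ?A"], rule exI[of _ "(points Q \<times> V) \<times> points MG"],
        rule exI[of _ ?\<theta>], rule exI[of _ "\<lambda>z. (fst (fst z), \<Psi> (snd (fst z), snd z))"],
        rule exI[of _ X], rule exI[of _ ?\<gamma>], intro conjI ballI)
    qed (fact trivialization_prod[OF pb V(1) s] pA X sm gr)+
  qed
qed

text \<open>The map is even a diffeomorphism of the whole image onto \<open>U'\<close>, with inverse \<open>h\<close>, so that the
  neighbourhood in the definition can be taken to be everything.\<close>

lemma section_image_local_diffeomorphism:
  assumes pb: "principal_bundle G MG Q l B" and U': "openin (mtop (prod_manifold Q B)) U'"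
    and h: "\<And>x. x \<in> U' \<Longrightarrow> smooth_at (prod_manifold Q B) (prod_manifold Q Q) h x"
    and sec: "\<And>x. x \<in> U' \<Longrightarrow> id_times_pi G l (h x) = x"
    and W: "embedded_submanifold (prod_manifold Q Q) (h ` U') W"
  shows "local_diffeomorphism (submanifold (prod_manifold Q Q) (h ` U') W) (prod_manifold Q B) (id_times_pi G l)"
proof -
  note Q = principal_bundle_smooth_atlas(2)[OF pb] and B = principal_bundle_smooth_atlas(3)[OF pb]
  note QQ = smooth_atlas_prod_manifold[OF Q Q] and QB = smooth_atlas_prod_manifold[OF Q B]
  let ?S = "h ` U'" and ?f = "id_times_pi G l" and ?QQ = "prod_manifold Q Q" and ?QB = "prod_manifold Q B"
  let ?H = "submanifold ?QQ ?S W"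
  note H = smooth_atlas_submanifold[OF QQ W]
  have pH: "points ?H = ?S"
    by (rule points_submanifold[OF W])
  have S: "openin (mtop ?H) ?S"
    using openin_topspace[of "mtop ?H"] pH by simp
  note OH = smooth_atlas_open_submanifold[OF H S] and OQB = smooth_atlas_open_submanifold[OF QB U']
  note pO = points_open_submanifold[OF S] points_open_submanifold[OF U']
  have fS: "?f ` ?S = U'"
    unfolding image_image by (simp only: sec image_ident cong: image_cong)
  have inj: "inj_on ?f ?S"
    by (rule inj_on_inverseI[of _ h]) (metis imageE sec)
  have "diffeomorphism (open_submanifold ?H ?S) (open_submanifold ?QB U') ?f"
    unfolding diffeomorphism_def pO
  proof (intro conjI)
    show "bij_betw ?f ?S U'"
      using inj fS by (simp add: bij_betw_def)
    have "smooth_at ?H (open_submanifold ?QB U') ?f p" if p: "p \<in> ?S" for p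
    proof -
      have "p \<in> points Q \<times> points Q"
        using p W by (auto simp: embedded_submanifold_def)
      then have "smooth_at ?H ?QB ?f p"
        by (rule smooth_at_compose[OF H QQ smooth_at_submanifold_inclusion[OF QQ W p] smooth_at_id_times_pi[OF pb]])
      then show ?thesis
        using smooth_at_into_open_submanifold[OF H QB U'] fS p by blast
    qed
    then show "smooth_map (open_submanifold ?H ?S) (open_submanifold ?QB U') ?f"
      using smooth_map_open_submanifold_iff[OF H OQB S] by blast
    have "smooth_at ?QB (open_submanifold ?H ?S) (inv_into ?S ?f) x" if x: "x \<in> U'" for x
    proof -
      have "smooth_at ?QB ?H h x"
        by (rule smooth_at_into_submanifold[OF QB QQ W h[OF x] U' x]) simp
      then have "smooth_at ?QB (open_submanifold ?H ?S) h x"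
        using smooth_at_into_open_submanifold[OF QB H S] x by blast
      moreover have "h y = inv_into ?S ?f y" if "y \<in> U'" for y
        using inv_into_f_f[OF inj, of "h y"] sec that by simp
      ultimately show ?thesis
        by (rule smooth_at_cong[OF _ U' x])
    qed
    then show "smooth_map (open_submanifold ?QB U') (open_submanifold ?H ?S) (inv_into ?S ?f)"
      using smooth_map_open_submanifold_iff[OF QB OH U'] by blast
  qed
  then show ?thesis
    unfolding local_diffeomorphism_def pH using S U' fS by (intro ballI exI[of _ ?S]) simp
qed

text \<open>The domain of the connection consists of the pairs in the fibres of \<open>id \<times> \<pi>\<close> over \<open>U'\<close> since two
  points with the same orbit differ by a group element.\<close>

lemma section_determines_connection:
  assumes pb: "principal_bundle G MG Q l B" and U': "openin (mtop (prod_manifold Q B)) U'"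
    and inv: "invariant_set G (act_QB l) U'"
    and h: "smooth_map (open_submanifold (prod_manifold Q B) U') (prod_manifold Q Q) h"
    and equiv: "equivariant_on G U' (act_QB l) (act_QQ l) h"
    and sec: "\<And>x. x \<in> U' \<Longrightarrow> id_times_pi G l (h x) = x"
    and diag: "\<And>q. q \<in> points Q \<Longrightarrow> (q, orbit G l q) \<in> U' \<and> h (q, orbit G l q) = (q, q)"
  shows "discrete_connection G Q l B (h ` U')" "lift_domain G l (h ` U') = U'"
    "\<And>x. x \<in> U' \<Longrightarrow> h x = horizontal_lift G l (h ` U') x"
    "connection_domain G l (h ` U') = {x \<in> points Q \<times> points Q. id_times_pi G l x \<in> U'}"
proof -
  note Q = principal_bundle_smooth_atlas(2)[OF pb] and B = principal_bundle_smooth_atlas(3)[OF pb]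
  note QQ = smooth_atlas_prod_manifold[OF Q Q] and QB = smooth_atlas_prod_manifold[OF Q B]
  interpret group_action G "points Q" l
    using pb by (simp add: principal_bundle_def smooth_action_def)
  have sm: "smooth_at (prod_manifold Q B) (prod_manifold Q Q) h x" if "x \<in> U'" for x
    using h smooth_map_open_submanifold_iff[OF QB QQ U'] that by blast
  have hp: "h x \<in> points Q \<times> points Q" if "x \<in> U'" for x
    using smooth_at_in_points(2)[OF sm[OF that]] by simp
  have inj: "inj_on (id_times_pi G l) (h ` U')"
    by (rule inj_on_inverseI[of _ h]) (metis imageE sec)
  show "discrete_connection G Q l B (h ` U')"
    unfolding discrete_connection_def
  proof (intro conjI inj)
    show "invariant_set G (act_QQ l) (h ` U')"
      unfolding invariant_set_def
    proof (intro ballI, elim imageE)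
      fix g p x assume g: "g \<in> carrier G" and p: "p = h x" and x: "x \<in> U'"
      have "act_QQ l g p = h (act_QB l g x)"
        using equiv g p x by (simp add: equivariant_on_def)
      then show "act_QQ l g p \<in> h ` U'"
        using inv g x by (simp add: invariant_set_def)
    qed
    show "Id_on (points Q) \<subseteq> h ` U'"
    proof
      fix p assume "p \<in> Id_on (points Q)"
      then obtain q where "q \<in> points Q" "p = (q, q)" by auto
      then show "p \<in> h ` U'"
        using diag[of q] imageI[of "(q, orbit G l q)" U' h] by simp
    qed
    obtain W where "embedded_submanifold (prod_manifold Q Q) (h ` U') W"
      using section_image_embedded_submanifold[OF pb U' sm sec] by blast
    then show "\<exists>W. embedded_submanifold (prod_manifold Q Q) (h ` U') W \<and>
        local_diffeomorphism (submanifold (prod_manifold Q Q) (h ` U') W) (prod_manifold Q B) (id_times_pi G l)"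
      using section_image_local_diffeomorphism[OF pb U' sm sec] by blast
  qed
  show "lift_domain G l (h ` U') = U'"
    unfolding lift_domain_def image_image by (simp only: sec image_ident cong: image_cong)
  show "h x = horizontal_lift G l (h ` U') x" if "x \<in> U'" for x
    using horizontal_lift_id_times_pi[OF inj, of "h x"] sec that by simp
  show "connection_domain G l (h ` U') = {x \<in> points Q \<times> points Q. id_times_pi G l x \<in> U'}"
  proof (intro equalityI subsetI)
    fix y assume "y \<in> connection_domain G l (h ` U')"
    then obtain a b g where y: "y = (a, l g b)" "(a, b) \<in> h ` U'" "g \<in> carrier G"
      by (auto simp: connection_domain_def)
    then obtain x where x: "x \<in> U'" "h x = (a, b)"
      by (metis imageE)
    then have "a \<in> points Q" "b \<in> points Q" "(a, orbit G l b) \<in> U'"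
      using hp[OF x(1)] sec[OF x(1)] by auto
    then show "y \<in> {x \<in> points Q \<times> points Q. id_times_pi G l x \<in> U'}"
      using y(1,3) element_image orbit_translate by auto
  next
    fix y assume "y \<in> {x \<in> points Q \<times> points Q. id_times_pi G l x \<in> U'}"
    then obtain a q where y: "y = (a, q)" "q \<in> points Q" "(a, orbit G l q) \<in> U'" by auto
    obtain a' b where hy: "h (a, orbit G l q) = (a', b)" by force
    then have b: "a' = a" "orbit G l b = orbit G l q"
      using sec[OF y(3)] by auto
    then have "q \<in> orbit G l b"
      using orbit_refl[OF y(2)] by simp
    then obtain g where "g \<in> carrier G" "q = l g b"
      by (auto simp: orbit_def)
    moreover have "(a, b) \<in> h ` U'"
      using imageI[OF y(3), of h] hy b(1) by simp
    ultimately show "y \<in> connection_domain G l (h ` U')"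
      using y(1) by (auto simp: connection_domain_def)
  qed
qed

text \<open>The reason for uniqueness: the lift and its domain determine the connection.\<close>

lemma discrete_connection_eq_lift_image:
  assumes "discrete_connection G Q l B Hor"
  shows "Hor = horizontal_lift G l Hor ` lift_domain G l Hor"
proof -
  have "inj_on (id_times_pi G l) Hor"
    using assms by (simp add: discrete_connection_def)
  then have "horizontal_lift G l Hor (id_times_pi G l p) = p" if "p \<in> Hor" for p
    using horizontal_lift_id_times_pi that by metis
  then show ?thesis
    by (simp add: lift_domain_def image_image)
qed

theorem theorem4p4:
  fixes G :: "('g, 'x) monoid_scheme"
    and MG :: "('g, 'd::euclidean_space) manifold"
    and Q :: "('q, 'e::euclidean_space) manifold"
    and l :: "'g \<Rightarrow> 'q \<Rightarrow> 'q"
    and B :: "('q set, 'b::euclidean_space) manifold"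
  assumes "principal_bundle G MG Q l B"
  shows
    "(\<forall>Hor. discrete_connection G Q l B Hor \<longrightarrow>
        openin (mtop (prod_manifold Q B)) (lift_domain G l Hor) \<and>
        invariant_set G (act_QB l) (lift_domain G l Hor) \<and>
        smooth_map (open_submanifold (prod_manifold Q B) (lift_domain G l Hor))
          (prod_manifold Q Q) (horizontal_lift G l Hor) \<and>
        equivariant_on G (lift_domain G l Hor) (act_QB l) (act_QQ l) (horizontal_lift G l Hor) \<and>
        (\<forall>x\<in>lift_domain G l Hor. id_times_pi G l (horizontal_lift G l Hor x) = x) \<and>
        (\<forall>q0\<in>points Q. (q0, orbit G l q0) \<in> lift_domain G l Hor \<and>
           horizontal_lift G l Hor (q0, orbit G l q0) = (q0, q0))) \<and>
     (\<forall>U' h.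
        openin (mtop (prod_manifold Q B)) U' \<and>
        invariant_set G (act_QB l) U' \<and>
        smooth_map (open_submanifold (prod_manifold Q B) U') (prod_manifold Q Q) h \<and>
        equivariant_on G U' (act_QB l) (act_QQ l) h \<and>
        (\<forall>x\<in>U'. id_times_pi G l (h x) = x) \<and>
        (\<forall>q0\<in>points Q. (q0, orbit G l q0) \<in> U' \<and> h (q0, orbit G l q0) = (q0, q0))
        \<longrightarrow>
        (\<exists>!Hor. discrete_connection G Q l B Hor \<and>
           connection_domain G l Hor = {x \<in> points Q \<times> points Q. id_times_pi G l x \<in> U'} \<and>
           U' = lift_domain G l Hor \<and>
           (\<forall>x\<in>U'. h x = horizontal_lift G l Hor x)))"
proof (intro conjI allI impI, goal_cases)
  case (7 U' h)
  then have U': "openin (mtop (prod_manifold Q B)) U'" and inv: "invariant_set G (act_QB l) U'"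
    and h: "smooth_map (open_submanifold (prod_manifold Q B) U') (prod_manifold Q Q) h"
    and equiv: "equivariant_on G U' (act_QB l) (act_QQ l) h"
    and sec: "\<forall>x\<in>U'. id_times_pi G l (h x) = x"
    and diag: "\<forall>q0\<in>points Q. (q0, orbit G l q0) \<in> U' \<and> h (q0, orbit G l q0) = (q0, q0)"
    by - (elim conjE, assumption)+
  have sec': "id_times_pi G l (h x) = x" if "x \<in> U'" for x
    by (rule bspec[OF sec that])
  have diag': "(q, orbit G l q) \<in> U' \<and> h (q, orbit G l q) = (q, q)" if "q \<in> points Q" for q
    by (rule bspec[OF diag that])
  note con = section_determines_connection[OF assms U' inv h equiv]
  show ?case
  proof (rule ex1I[of _ "h ` U'"], intro conjI ballI)
    fix Hor assume Hor: "discrete_connection G Q l B Hor \<and>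
        connection_domain G l Hor = {x \<in> points Q \<times> points Q. id_times_pi G l x \<in> U'} \<and>
        U' = lift_domain G l Hor \<and> (\<forall>x\<in>U'. h x = horizontal_lift G l Hor x)"
    have "Hor = horizontal_lift G l Hor ` lift_domain G l Hor"
      by (rule discrete_connection_eq_lift_image[OF conjunct1[OF Hor]])
    also have "\<dots> = h ` U'"
      using Hor by (intro image_cong) auto
    finally show "Hor = h ` U'" .
  next
    show "discrete_connection G Q l B (h ` U')"
      by (rule con(1)[OF sec' diag'])
    show "connection_domain G l (h ` U') = {x \<in> points Q \<times> points Q. id_times_pi G l x \<in> U'}"
      by (rule con(4)[OF sec' diag'])
    show "U' = lift_domain G l (h ` U')"
      by (rule con(2)[OF sec' diag', symmetric])
    show "h x = horizontal_lift G l (h ` U') x" if "x \<in> U'" for x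
      by (rule con(3)[OF sec' diag' that])
  qed
qed (fact horizontal_lift_properties[OF assms])+

end
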